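(* Let $d\geq3$ be an integer, and let $\mathcal D\subset\mathbb{R}_{\geq0}^d$ be a bounded set with nonempty interior. Then there is a constant $C>0$ which depends only on $d$ and $\mathcal D$ such that $$P_d(T,R)\leq C\,R^{-\frac12(d-1)}\bigl(\log(R+2)\bigr)^{\frac12(d-3)}$$ for all $T>0$ with $\widehat{\mathbb{N}}^d\cap T\mathcal D\neq\emptyset$ and all $R>0$. Furthermore, for any such $T$, $$P_d(T,R)=0\qquad\text{whenever } R\geq d\Bigl(T\sup_{\boldsymbol x\in\mathcal D}\|\boldsymbol x\|\Bigr)^{1-\frac1{d-1}}.$$
   Context: $\widehat{\mathbb{N}}^d$ is the set of vectors $\boldsymbol a=(a_1,\ldots,a_d)$ with positive integer coefficients whose greatest common divisor is $1$. For $\boldsymbol a\in\widehat{\mathbb{N}}^d$, the Frobenius number $g(\boldsymbol a)$ is the largest integer which is not representable as a non-negative integer linear combination of $a_1,\ldots,a_d$, and $f(\boldsymbol a)=g(\boldsymbol a)+a_1+\cdots+a_d$. $\|\cdot\|$ is the standard Euclidean norm. For $R>0$ and $T>0$ with $\widehat{\mathbb{N}}^d\cap T\mathcal D\neq\emptyset$, define $$P_d(T,R)=\frac{\#\bigl\{\boldsymbol a\in\widehat{\mathbb{N}}^d\cap T\mathcal D : f(\boldsymbol a)/(a_1\cdots a_d)^{1/(d-1)}>R\bigr\}}{\#(\widehat{\mathbb{N}}^d\cap T\mathcal D)}.$$ *)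

theory Defs
  imports "HOL-Analysis.Analysis"
begin

text \<open>The dimension \<open>d\<close> is \<open>CARD('n)\<close>.\<close>

definition primitive_vectors :: "(nat ^ 'n::finite) set" where
  "primitive_vectors = {a. (\<forall>i. 0 < a $ i) \<and> Gcd (range (\<lambda>i. a $ i)) = 1}"

definition representable :: "nat ^ 'n::finite \<Rightarrow> int \<Rightarrow> bool" where
  "representable a m \<longleftrightarrow> (\<exists>x :: nat ^ 'n. m = (\<Sum>i\<in>UNIV. int (x $ i) * int (a $ i)))"

text \<open>Ranging over all integers matters: the value is \<open>-1\<close> if some entry of \<open>a\<close> is \<open>1\<close>.
  For \<open>a \<in> primitive_vectors\<close> the greatest element exists, since all sufficiently large
  integers are representable and no negative integer is.\<close>

definition frobenius_number :: "nat ^ 'n::finite \<Rightarrow> int" where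
  "frobenius_number a = (GREATEST m. \<not> representable a m)"

definition shifted_frobenius :: "nat ^ 'n::finite \<Rightarrow> int" where
  "shifted_frobenius a = frobenius_number a + (\<Sum>i\<in>UNIV. int (a $ i))"

definition primitive_in_dilate :: "(real ^ 'n::finite) set \<Rightarrow> real \<Rightarrow> (nat ^ 'n) set" where
  "primitive_in_dilate D T =
     {a \<in> primitive_vectors. (\<chi> i. real (a $ i)) \<in> (\<lambda>x. T *\<^sub>R x) ` D}"

text \<open>Meaningful when \<open>primitive_in_dilate D T\<close> is nonempty and finite; finiteness is
  automatic for bounded \<open>D\<close>.\<close>

definition frobenius_tail :: "(real ^ 'n::finite) set \<Rightarrow> real \<Rightarrow> real \<Rightarrow> real" where
  "frobenius_tail D T R =
     real (card {a \<in> primitive_in_dilate D T.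
        real_of_int (shifted_frobenius a)
          / real (\<Prod>i\<in>UNIV. a $ i) powr (1 / (real CARD('n) - 1)) > R})
     / real (card (primitive_in_dilate D T))"

end

theory Submission
  imports Defs "HOL-Number_Theory.Cong"
begin

text \<open>
  Write \<open>d\<close> for the dimension, fix a coordinate \<open>m\<close> and put \<open>q = a\<^sub>m\<close>, \<open>l = d - 1\<close>. If every residue
  modulo \<open>q\<close> is a sum of the other \<open>a\<^sub>i\<close> with at most \<open>l (N\<^sub>i - 1)\<close> copies of each, then
  \<open>f(a) \<le> l \<Sum> N\<^sub>i a\<^sub>i\<close>. By characters modulo \<open>q\<close> this is the case as soon as
  \<open>\<Sum>\<^sub>k \<Prod>\<^sub>i (\<bar>\<Sum>\<^sub>n e(n k a\<^sub>i / q)\<bar> / N\<^sub>i)\<^sup>l < 1\<close>, where \<open>0 < k < q\<close>, \<open>i \<noteq> m\<close> and \<open>0 \<le> n < N\<^sub>i\<close>. Averaging the left side over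
  primitive \<open>a\<close> in \<open>[1,T]\<^sup>d\<close>, with \<open>k/q\<close> sorted by its reduced denominator, bounds the number of
  \<open>a\<close> violating the criterion; primitivity excludes the case that all \<open>a\<^sub>i\<close> are multiples of that
  denominator. Vectors with an exceptionally small product of coordinates are discarded first by
  Rankin's trick. The vanishing of the tail is Schur's bound \<open>f(a) \<le> (d - 1) min a\<^sub>i max a\<^sub>i\<close>.
\<close>

subsection \<open>Sums over boxes of vectors\<close>

text \<open>The exponent \<open>l = d - 1\<close> in the criterion makes the average independent of
  the reduced denominator \<open>r\<close> when \<open>r\<close> is at most all
  \<open>N\<^sub>i\<close>: the sum over each of the \<open>l\<close> coordinates is of order
  \<open>T / r\<close>, while one coordinate that is not a multiple of \<open>r\<close> saves
  \<open>(r / N\<^sub>i) ^ l\<close>, so the powers of \<open>r\<close> cancel. The obstacle is the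
  vectors whose product is a small multiple of \<open>T ^ d\<close>. Discarding the multiples up to
  \<open>P\<close> costs about \<open>P\<close> times logarithms; with equal
  \<open>N\<^sub>i\<close> the rest costs about \<open>R powr - l / P\<close>. Rankin's trick turns
  the logarithms into a factor \<open>P powr - \<eta>\<close>, and a larger \<open>N\<^sub>j\<close>
  at the smallest coordinate wins the factor \<open>P powr \<eta>\<close> in the second count. Then
  \<open>P powr (1 - \<eta>)\<close> and \<open>R powr - l * P powr (\<eta> - 1)\<close> agree at
  \<open>R powr (- l / 2)\<close>, without any logarithm; the logarithmic factor enters only at the
  end. Denominators up to \<open>N\<^sub>j\<close> do not profit from the larger
  \<open>N\<^sub>j\<close>. For them Schur's bound is used a second time: as soon as one vector is
  bad, \<open>R\<close> is at most \<open>l * T powr (1 - 1 / l)\<close>.\<close>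

lemma inj_vec_nth: "inj vec_nth"
  by (auto intro: injI simp: vec_nth_inject)

lemma bij_betw_vec_nth:
  "bij_betw vec_nth {a :: 'a ^ 'n::finite. \<forall>i. a $ i \<in> A i} (Pi\<^sub>E UNIV A)"
proof -
  have "vec_nth ` {a :: 'a ^ 'n. \<forall>i. a $ i \<in> A i} = Pi\<^sub>E UNIV A"
  proof (intro equalityI subsetI)
    fix g assume "g \<in> Pi\<^sub>E UNIV A"
    then show "g \<in> vec_nth ` {a. \<forall>i. a $ i \<in> A i}"
      by (intro image_eqI[of _ _ "vec_lambda g"]) (auto simp: vec_lambda_inverse)
  qed auto
  then show ?thesis
    by (auto simp: bij_betw_def intro: inj_on_subset[OF inj_vec_nth])
qed

lemma sum_vec_prod:
  fixes h :: "'n::finite \<Rightarrow> 'a \<Rightarrow> 'b :: comm_semiring_1"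
  assumes "\<And>i. finite (A i)"
  shows "(\<Sum>a\<in>{a :: 'a ^ 'n. \<forall>i. a $ i \<in> A i}. \<Prod>i\<in>UNIV. h i (a $ i)) = (\<Prod>i\<in>UNIV. \<Sum>x\<in>A i. h i x)"
proof -
  have "(\<Prod>i\<in>UNIV. \<Sum>x\<in>A i. h i x) = (\<Sum>g\<in>Pi\<^sub>E UNIV A. \<Prod>i\<in>UNIV. h i (g i))"
    using assms by (intro prod_sum_PiE) auto
  also have "\<dots> = (\<Sum>a\<in>{a :: 'a ^ 'n. \<forall>i. a $ i \<in> A i}. \<Prod>i\<in>UNIV. h i (a $ i))"
    by (rule sum.reindex_bij_betw[OF bij_betw_vec_nth, symmetric])
  finally show ?thesis ..
qed

lemma card_vec:
  fixes A :: "'n::finite \<Rightarrow> 'a set"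
  shows "card {a :: 'a ^ 'n. \<forall>i. a $ i \<in> A i} = (\<Prod>i\<in>UNIV. card (A i))"
  using bij_betw_same_card[OF bij_betw_vec_nth[of A]] by (simp add: card_PiE)

lemma finite_vec:
  fixes A :: "'n::finite \<Rightarrow> 'a set"
  assumes "\<And>i. finite (A i)"
  shows "finite {a :: 'a ^ 'n. \<forall>i. a $ i \<in> A i}"
  using bij_betw_finite[OF bij_betw_vec_nth[of A]] assms by (simp add: finite_PiE)

subsection \<open>Exponential sums and representable residues\<close>

text \<open>Modulus of the Fourier transform of the uniform distribution on \<open>{..<N}\<close>;
  for \<open>N > 0\<close> the trivial frequency has value 1.\<close>

definition expsum_ratio :: "nat \<Rightarrow> real \<Rightarrow> real" where
  "expsum_ratio N t = norm (\<Sum>n<N. cis (2 * pi * real n * t)) / real N"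

lemma expsum_ratio_nonneg: "0 \<le> expsum_ratio N t"
  by (simp add: expsum_ratio_def)

lemma expsum_ratio_le_1: "expsum_ratio N t \<le> 1"
proof -
  have "norm (\<Sum>n<N. cis (2 * pi * real n * t)) \<le> (\<Sum>n<N. norm (cis (2 * pi * real n * t)))"
    by (rule norm_sum)
  then show ?thesis
    by (cases "N = 0") (auto simp: expsum_ratio_def divide_le_eq)
qed

lemma cis_eq_1_of_int: "cis (2 * pi * of_int z) = 1"
  by (metis cis_multiple_2pi Ints_of_int)

lemma sum_roots_of_unity:
  fixes q :: nat and z :: int
  assumes "q > 0" "\<not> int q dvd z"
  shows "(\<Sum>k<q. cis (2 * pi * real k * (of_int z / real q))) = 0"
proof -
  let ?w = "cis (2 * pi * (of_int z / real q))"
  have pw: "cis (2 * pi * real k * (of_int z / real q)) = ?w ^ k" for k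
    by (subst Complex.DeMoivre) (simp add: algebra_simps)
  have "?w \<noteq> 1"
  proof
    assume "?w = 1"
    then have "cos (2 * pi * (of_int z / real q)) = 1"
      by (simp add: complex_eq_iff)
    then obtain x :: int where "2 * pi * (of_int z / real q) = of_int x * (2 * pi)"
      using cos_one_2pi_int by auto
    then have "of_int z = real_of_int x * real q"
      using assms(1) by (simp add: field_simps)
    then have "z = x * int q"
      by (metis of_int_eq_iff of_int_mult of_int_of_nat_eq)
    then show False using assms(2) by simp
  qed
  moreover have "?w ^ q = 1"
  proof -
    have "?w ^ q = cis (2 * pi * of_int z)"
      using assms(1) by (subst Complex.DeMoivre) (simp add: algebra_simps)
    then show ?thesis by (simp add: cis_eq_1_of_int)
  qed
  ultimately show ?thesis
    unfolding pw by (simp add: geometric_sum)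
qed

text \<open>The weighted number of representations of \<open>r\<close> is a character sum whose trivial term
  dominates the others.\<close>

lemma residue_representable_if_small_expsums:
  fixes M b :: "'j \<Rightarrow> nat" and q :: nat and r :: int
  assumes fin: "finite J" and q: "q > 0" and M: "\<And>j. j \<in> J \<Longrightarrow> M j > 0"
    and small: "(\<Sum>k\<in>{1..<q}. \<Prod>j\<in>J. expsum_ratio (M j) (real k * real (b j) / real q)) < 1"
  obtains g where "g \<in> Pi\<^sub>E J (\<lambda>j. {..<M j})" "int q dvd (\<Sum>j\<in>J. int (g j) * int (b j)) - r"
proof -
  define e where "e z k = cis (2 * pi * real k * (of_int z / real q))" for z :: int and k :: nat
  have e_prod: "(\<Prod>j\<in>J. e (h j) k) = e (\<Sum>j\<in>J. h j) k" for h k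
    using fin by (induction J) (auto simp: e_def cis_mult algebra_simps add_divide_distrib)
  have e_add: "e z k * e z' k = e (z + z') k" for z z' k
    by (simp add: e_def cis_mult algebra_simps add_divide_distrib)
  define S where "S j k = (\<Sum>n<M j. e (int n * int (b j)) k)" for j k
  have S_norm: "norm (S j k) = expsum_ratio (M j) (real k * real (b j) / real q) * real (M j)" if "j \<in> J" for j k
    using M[OF that] by (simp add: S_def e_def expsum_ratio_def algebra_simps)
  have S_expand: "(\<Prod>j\<in>J. S j k) = (\<Sum>g\<in>Pi\<^sub>E J (\<lambda>j. {..<M j}). e (\<Sum>j\<in>J. int (g j) * int (b j)) k)" for k
    unfolding S_def using fin by (subst prod_sum_PiE) (auto simp: e_prod)
  note result = that
  show ?thesis
  proof (rule ccontr)
    assume "\<not> thesis"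
    then have no: "\<not> int q dvd (\<Sum>j\<in>J. int (g j) * int (b j)) - r" if g: "g \<in> Pi\<^sub>E J (\<lambda>j. {..<M j})" for g
      using result[OF g] by blast
    \<comment> \<open>By orthogonality this sum is \<open>q\<close> times the number of
      representations of \<open>r\<close> modulo \<open>q\<close>, hence 0 here. Its
      \<open>k = 0\<close> term is the product of all \<open>M j\<close> and has to be cancelled by
      the other terms.\<close>
    have "(\<Sum>k<q. e (- r) k * (\<Prod>j\<in>J. S j k)) =
        (\<Sum>g\<in>Pi\<^sub>E J (\<lambda>j. {..<M j}). \<Sum>k<q. e ((\<Sum>j\<in>J. int (g j) * int (b j)) - r) k)"
      unfolding S_expand sum_distrib_left e_add by (subst sum.swap) (simp add: algebra_simps)
    also have "\<dots> = 0"
      unfolding e_def by (intro sum.neutral ballI sum_roots_of_unity q no)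
    finally have "0 = (\<Sum>k<q. e (- r) k * (\<Prod>j\<in>J. S j k))" ..
    also have "\<dots> = (\<Prod>j\<in>J. of_nat (M j)) + (\<Sum>k\<in>{1..<q}. e (- r) k * (\<Prod>j\<in>J. S j k))"
    proof -
      have "{..<q} = insert 0 {1..<q}" using q by auto
      then show ?thesis by (simp add: e_def S_def)
    qed
    finally have "norm (\<Prod>j\<in>J. of_nat (M j) :: complex) = norm (\<Sum>k\<in>{1..<q}. e (- r) k * (\<Prod>j\<in>J. S j k))"
      by (metis add_eq_0_iff norm_minus_cancel)
    also have "\<dots> \<le> (\<Sum>k\<in>{1..<q}. \<Prod>j\<in>J. norm (S j k))"
      by (rule order_trans[OF norm_sum]) (simp add: norm_mult e_def prod_norm)
    also have "\<dots> = (\<Sum>k\<in>{1..<q}. \<Prod>j\<in>J. expsum_ratio (M j) (real k * real (b j) / real q)) * (\<Prod>j\<in>J. real (M j))"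
      by (simp add: S_norm prod.distrib sum_distrib_right)
    also have "\<dots> < 1 * (\<Prod>j\<in>J. real (M j))"
      using small M by (intro mult_strict_right_mono prod_pos) auto
    finally show False by (simp flip: prod_norm)
  qed
qed

text \<open>Taking \<open>l\<close> copies of every generator, indexed by
  \<open>J \<times> {..<l}\<close>, turns each factor into its \<open>l\<close>-th power; adding up
  the copies gives the multiplicities.\<close>

lemma multiple_representable_if_small_expsums:
  fixes N b :: "'j \<Rightarrow> nat" and q l :: nat and r :: int
  assumes fin: "finite J" and q: "q > 0" and N: "\<And>j. j \<in> J \<Longrightarrow> N j > 0"
    and small: "(\<Sum>k\<in>{1..<q}. \<Prod>j\<in>J. expsum_ratio (N j) (real k * real (b j) / real q) ^ l) < 1"
  obtains x where "\<And>j. j \<in> J \<Longrightarrow> x j \<le> l * (N j - 1)" "int q dvd (\<Sum>j\<in>J. int (x j) * int (b j)) - r"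
proof -
  let ?J = "J \<times> {..<l}"
  have "(\<Prod>p\<in>?J. expsum_ratio (N (fst p)) (real k * real (b (fst p)) / real q))
      = (\<Prod>j\<in>J. expsum_ratio (N j) (real k * real (b j) / real q) ^ l)" for k
    using prod.cartesian_product[of "\<lambda>j t. expsum_ratio (N j) (real k * real (b j) / real q)" "{..<l}" J]
    by (simp add: case_prod_unfold)
  then have "(\<Sum>k\<in>{1..<q}. \<Prod>p\<in>?J. expsum_ratio (N (fst p)) (real k * real (b (fst p)) / real q)) < 1"
    using small by simp
  then obtain g where g: "g \<in> Pi\<^sub>E ?J (\<lambda>p. {..<N (fst p)})"
      "int q dvd (\<Sum>p\<in>?J. int (g p) * int (b (fst p))) - r"
    using fin q N
    by (elim residue_representable_if_small_expsums[of ?J q "\<lambda>p. N (fst p)" "\<lambda>p. b (fst p)" r, rotated 3])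
      auto
  show ?thesis
  proof
    fix j assume "j \<in> J"
    then have "g (j, t) \<le> N j - 1" if "t < l" for t
      using g(1) that N[of j] by (force simp: PiE_def Pi_def)
    then show "(\<Sum>t<l. g (j, t)) \<le> l * (N j - 1)"
      using sum_bounded_above[of "{..<l}" "\<lambda>t. g (j, t)" "N j - 1"] by simp
  next
    show "int q dvd (\<Sum>j\<in>J. int (\<Sum>t<l. g (j, t)) * int (b j)) - r"
      using g(2) by (simp add: sum_distrib_right sum.cartesian_product case_prod_unfold)
  qed
qed

subsection \<open>Upper bounds for the Frobenius number\<close>

text \<open>An integer \<open>z > B - a $ m\<close> is congruent to some sum of the other
  coordinates of size at most \<open>B\<close>; the difference is a multiple of \<open>a $ m\<close>
  exceeding \<open>- a $ m\<close>, hence nonnegative. So the Frobenius number is at most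
  \<open>B - a $ m\<close>, and adding all coordinates cancels \<open>a $ m\<close>.\<close>

lemma shifted_frobenius_le:
  fixes a :: "nat ^ 'n::finite" and B :: int
  assumes a: "\<And>i. 0 < a $ i"
    and cover: "\<And>r. \<exists>x. int (a $ m) dvd (\<Sum>i\<in>- {m}. int (x i) * int (a $ i)) - r
                  \<and> (\<Sum>i\<in>- {m}. int (x i) * int (a $ i)) \<le> B"
  shows "shifted_frobenius a \<le> B + (\<Sum>i\<in>- {m}. int (a $ i))"
proof -
  have split: "(\<Sum>i\<in>UNIV. h i) = h m + (\<Sum>i\<in>- {m}. h i)" for h :: "'n \<Rightarrow> int"
    by (simp add: Compl_eq_Diff_UNIV sum.remove[of UNIV m])
  have rep: "representable a z" if z: "z > B - int (a $ m)" for z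
  proof -
    obtain x where x: "int (a $ m) dvd (\<Sum>i\<in>- {m}. int (x i) * int (a $ i)) - z"
      "(\<Sum>i\<in>- {m}. int (x i) * int (a $ i)) \<le> B"
      using cover by blast
    then obtain t where t: "z - (\<Sum>i\<in>- {m}. int (x i) * int (a $ i)) = int (a $ m) * t"
      by (metis dvd_def dvd_diff_commute)
    have "int (a $ m) * t > int (a $ m) * (- 1)"
      using x(2) z unfolding t[symmetric] by linarith
    then have "t \<ge> 0"
      using a[of m] by (subst (asm) mult_less_cancel_left_pos) auto
    let ?x = "\<chi> i. if i = m then nat t else x i"
    have "z = (\<Sum>i\<in>UNIV. int (?x $ i) * int (a $ i))"
      using t \<open>t \<ge> 0\<close> by (subst split) (simp add: algebra_simps)
    then show ?thesis
      unfolding representable_def by blast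
  qed
  have neg: "\<not> representable a (- 1)"
  proof
    assume "representable a (- 1)"
    then obtain x :: "nat ^ 'n" where "(\<Sum>i\<in>UNIV. int (x $ i) * int (a $ i)) = - 1"
      unfolding representable_def by metis
    moreover have "(\<Sum>i\<in>UNIV. int (x $ i) * int (a $ i)) \<ge> 0"
      by (intro sum_nonneg) auto
    ultimately show False by linarith
  qed
  \<comment> \<open>No negative integer is representable, so the set is cut off at
    \<open>-1\<close>, which makes it finite and keeps it nonempty.\<close>
  define G where "G = {z. \<not> representable a z \<and> -1 \<le> z}"
  have le: "z \<le> B - int (a $ m)" if "\<not> representable a z" for z
    using rep[of z] that by linarith
  have "G \<subseteq> {-1..B - int (a $ m)}"
    using le by (auto simp: G_def)
  then have "finite G"
    by (rule finite_subset) simp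
  moreover have "-1 \<in> G"
    using neg by (simp add: G_def)
  ultimately have M: "Max G \<in> G" "\<And>z. z \<in> G \<Longrightarrow> z \<le> Max G"
    by (auto intro: Max_in)
  have "frobenius_number a = Max G"
    unfolding frobenius_number_def
  proof (rule Greatest_equality)
    show "\<not> representable a (Max G)"
      using M(1) by (simp add: G_def)
    fix z assume "\<not> representable a z"
    then show "z \<le> Max G"
      using M by (cases "z \<ge> -1") (force simp: G_def)+
  qed
  also have "\<dots> \<le> B - int (a $ m)"
    using M(1) le by (simp add: G_def)
  finally show ?thesis
    unfolding shifted_frobenius_def by (subst split) simp
qed

text \<open>Euclid's argument in an additively closed set of positive integers: the least element
  divides all others, hence \<open>q\<close> and every element of \<open>S\<close>. Counting words
  only up to congruence makes subtraction available.\<close>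

lemma residue_is_list_sum:
  fixes S :: "nat set" and q :: nat
  assumes q: "q > 0" and gcd: "\<And>h. h dvd q \<Longrightarrow> (\<And>s. s \<in> S \<Longrightarrow> h dvd s) \<Longrightarrow> h = 1"
  shows "\<exists>w. set w \<subseteq> S \<and> [sum_list w = n] (mod q)"
proof -
  define P where "P n \<longleftrightarrow> n > 0 \<and> (\<exists>w. set w \<subseteq> S \<and> [sum_list w = n] (mod q))" for n
  have P_cong: "P n'" if "P n" "[n = n'] (mod q)" "n' > 0" for n n'
    using that cong_trans unfolding P_def by blast
  have P_q: "P q"
    using q by (auto simp: P_def cong_def intro!: exI[of _ "[]"])
  have P_S: "P s" if "s \<in> S" "s > 0" for s
    using that by (auto simp: P_def intro!: exI[of _ "[s]"])
  have P_add: "P (m + n)" if "P m" "P n" for m n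
  proof -
    obtain v w where "set v \<subseteq> S" "[sum_list v = m] (mod q)" "set w \<subseteq> S" "[sum_list w = n] (mod q)"
      using \<open>P m\<close> \<open>P n\<close> unfolding P_def by blast
    then have "set (v @ w) \<subseteq> S \<and> [sum_list (v @ w) = m + n] (mod q)"
      by (auto intro: cong_add)
    then show ?thesis
      using \<open>P m\<close> unfolding P_def by blast
  qed
  have P_add_mult: "P (m + k * n)" if "P m" "P n" for k m n
  proof (induction k)
    case (Suc k)
    then show ?case
      using P_add[OF Suc that(2)] by (simp add: algebra_simps)
  qed (use that in simp)
  define h where "h = (LEAST n. P n)"
  have h: "P h" "\<And>n. P n \<Longrightarrow> h \<le> n"
    using P_q unfolding h_def by (auto intro: LeastI Least_le)
  have h_dvd: "h dvd n" if "P n" for n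
    using that
  proof (induction n rule: less_induct)
    case (less n)
    show ?case
    proof (cases "n = h")
      case False
      then have "h < n" "h > 0"
        using h less.prems by (auto simp: le_less P_def)
      \<comment> \<open>Adding \<open>h\<close> another \<open>q - 1\<close> times subtracts it
        modulo \<open>q\<close>.\<close>
      have "n + (q - 1) * h = (n - h) + q * h"
        using \<open>h < n\<close> q by (cases q) auto
      then have "[n + (q - 1) * h = n - h] (mod q)"
        by (simp add: cong_def)
      then have "P (n - h)"
        using P_cong[OF P_add_mult[OF less.prems h(1)]] \<open>h < n\<close> by simp
      then have "h dvd n - h"
        using less.IH \<open>h < n\<close> \<open>h > 0\<close> by simp
      then show ?thesis
        using \<open>h < n\<close> by (simp add: dvd_minus_self)
    qed simp
  qed
  have "h = 1"
    using P_q P_S h_dvd by (intro gcd) (metis dvd_0_right gr0I)+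
  \<comment> \<open>\<open>P\<close> holds only of positive numbers; the summand \<open>q\<close>
    covers \<open>n = 0\<close>.\<close>
  then have "P (q + n * 1)"
    using P_add_mult P_q h(1) by blast
  then show ?thesis
    by (auto simp: P_def cong_def)
qed

text \<open>In a shortest word for a given residue the partial sums are pairwise incongruent.\<close>

lemma residue_is_short_list_sum:
  fixes S :: "nat set" and q :: nat
  assumes q: "q > 0" and gcd: "\<And>h. h dvd q \<Longrightarrow> (\<And>s. s \<in> S \<Longrightarrow> h dvd s) \<Longrightarrow> h = 1"
  shows "\<exists>w. set w \<subseteq> S \<and> length w < q \<and> [sum_list w = n] (mod q)"
proof -
  define Q where "Q w \<longleftrightarrow> set w \<subseteq> S \<and> [sum_list w = n] (mod q)" for w
  have "\<exists>w. Q w"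
    unfolding Q_def by (rule residue_is_list_sum[OF assms])
  then obtain w where w: "Q w" "\<And>v. Q v \<Longrightarrow> length w \<le> length v"
    using ex_has_least_nat[of Q _ length] by metis
  have "length w < q"
  proof (rule ccontr)
    assume "\<not> length w < q"
    \<comment> \<open>There are \<open>length w + 1\<close> prefixes but only \<open>q\<close>
      residues; the segment between two congruent prefixes can be cut out.\<close>
    define p where "p i = sum_list (take i w) mod q" for i
    have "p ` {..length w} \<subseteq> {..<q}"
      using q by (auto simp: p_def)
    then have "card (p ` {..length w}) \<le> q"
      using card_mono[of "{..<q}"] by simp
    then have "\<not> inj_on p {..length w}"
      using \<open>\<not> length w < q\<close> by (auto dest: card_image)
    then obtain i j where ij: "i < j" "j \<le> length w" "p i = p j"
      unfolding inj_on_def by (metis atMost_iff linorder_neqE_nat)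
    let ?v = "take i w @ drop j w"
    have "[sum_list (take i w) + sum_list (drop j w) = sum_list (take j w) + sum_list (drop j w)] (mod q)"
      using ij(3) by (intro cong_add) (auto simp: p_def cong_def)
    then have "[sum_list ?v = sum_list w] (mod q)"
      by (simp flip: sum_list_append)
    moreover have "set ?v \<subseteq> set w"
      by (auto dest: in_set_takeD in_set_dropD)
    ultimately have "Q ?v"
      using w(1) unfolding Q_def by (auto intro: cong_trans)
    then show False
      using w(2) ij by fastforce
  qed
  then show ?thesis
    using w(1) unfolding Q_def by blast
qed

lemma primitive_vectorsD:
  assumes "a \<in> primitive_vectors"
  shows "0 < a $ i" "(\<And>i. h dvd a $ i) \<Longrightarrow> h = 1"
proof -
  show "0 < a $ i" using assms by (simp add: primitive_vectors_def)
  assume "\<And>i. h dvd a $ i"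
  then have "h dvd Gcd (range (\<lambda>i. a $ i))"
    by (intro Gcd_greatest) auto
  then show "h = 1" using assms by (simp add: primitive_vectors_def)
qed

text \<open>Every residue modulo \<open>a $ m\<close> is a sum of at most \<open>a $ m - 1\<close>
  other coordinates, each at most \<open>A\<close>. The index \<open>m\<close> is free; the smallest
  coordinate gives Schur's bound.\<close>

lemma shifted_frobenius_le_Schur:
  fixes a :: "nat ^ 'n::finite"
  assumes a: "a \<in> primitive_vectors" and A: "\<And>i. a $ i \<le> A"
  shows "shifted_frobenius a \<le> (int CARD('n) - 1) * int (a $ m) * int A" (is "_ \<le> ?rhs")
\<comment> \<open>In dimension one the right side is 0 and primitivity forces
  \<open>a $ m = 1\<close>. The general case ends with \<open>(q - 1) * (d - 2) \<ge> 0\<close>,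
  which relies on \<open>d \<ge> 2\<close>.\<close>
proof (cases "CARD('n) = 1")
  case True
  then have UNIV: "UNIV = {m}"
    by (metis UNIV_I card_1_singletonE singletonD)
  have "shifted_frobenius a \<le> 0 + (\<Sum>i\<in>- {m}. int (a $ i))"
  proof (rule shifted_frobenius_le)
    have "a $ m = 1"
      using UNIV by (intro primitive_vectorsD(2)[OF a, of "a $ m"]) (metis UNIV_I dvd_refl singletonD)
    then show "\<exists>x. int (a $ m) dvd (\<Sum>i\<in>- {m}. int (x i) * int (a $ i)) - r
                  \<and> (\<Sum>i\<in>- {m}. int (x i) * int (a $ i)) \<le> 0" for r
      using UNIV by (simp add: Compl_eq_Diff_UNIV)
  qed (rule primitive_vectorsD[OF a])
  then show ?thesis
    using UNIV by (simp add: Compl_eq_Diff_UNIV True)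
next
  case False
  let ?q = "a $ m"
  let ?S = "(\<lambda>i. a $ i) ` (- {m})"
  have q: "?q > 0" by (rule primitive_vectorsD[OF a])
  have bound: "shifted_frobenius a \<le> int (?q - 1) * int A + (\<Sum>i\<in>- {m}. int (a $ i))"
  proof (rule shifted_frobenius_le)
    fix r :: int
    have "\<exists>w. set w \<subseteq> ?S \<and> length w < ?q \<and> [sum_list w = nat (r mod int ?q)] (mod ?q)"
    proof (rule residue_is_short_list_sum[OF q])
      fix h assume "h dvd ?q" "\<And>s. s \<in> ?S \<Longrightarrow> h dvd s"
      then show "h = 1"
        by (intro primitive_vectorsD(2)[OF a]) (metis ComplI imageI singletonD)
    qed
    then obtain w where w: "set w \<subseteq> ?S" "length w < ?q" "[sum_list w = nat (r mod int ?q)] (mod ?q)"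
      by blast
    have "\<exists>x. sum_list w = (\<Sum>i\<in>- {m}. x i * a $ i)"
      using w(1)
    proof (induction w)
      case Nil
      then show ?case by (intro exI[of _ "\<lambda>_. 0"]) simp
    next
      case (Cons b w)
      then obtain x j where x: "sum_list w = (\<Sum>i\<in>- {m}. x i * a $ i)" and j: "j \<noteq> m" "b = a $ j"
        by auto
      have "sum_list (b # w) = (\<Sum>i\<in>- {m}. (x i + (if i = j then 1 else 0)) * a $ i)"
        using j by (simp add: x algebra_simps sum.distrib if_distrib[of "\<lambda>t. _ * t"] sum.delta cong: if_cong)
      then show ?case
        by (intro exI[of _ "\<lambda>i. x i + (if i = j then 1 else 0)"])
    qed
    then obtain x where x: "sum_list w = (\<Sum>i\<in>- {m}. x i * a $ i)" by blast
    have "sum_list w \<le> length w * A"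
      using w(1) A by (induction w) (auto simp: add_mono)
    also have "\<dots> \<le> (?q - 1) * A"
      using w(2) by (intro mult_right_mono) auto
    finally have "int (sum_list w) \<le> int (?q - 1) * int A"
      by (metis of_nat_mono of_nat_mult)
    moreover have "int ?q dvd int (sum_list w) - r"
    proof -
      have "[int (sum_list w) = int (nat (r mod int ?q))] (mod int ?q)"
        using w(3) by (subst cong_int_iff)
      then have "[int (sum_list w) = r] (mod int ?q)"
        using q by simp
      then show ?thesis
        by (simp add: cong_iff_dvd_diff)
    qed
    ultimately show "\<exists>x. int (a $ m) dvd (\<Sum>i\<in>- {m}. int (x i) * int (a $ i)) - r
                  \<and> (\<Sum>i\<in>- {m}. int (x i) * int (a $ i)) \<le> int (?q - 1) * int A"
      unfolding x by (intro exI[of _ x]) simp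
  qed (rule primitive_vectorsD[OF a])
  have "(\<Sum>i\<in>- {m}. int (a $ i)) \<le> (\<Sum>i\<in>- {m}. int A)"
    using A by (intro sum_mono) simp
  also have "\<dots> = (int CARD('n) - 1) * int A"
    by (simp add: Compl_eq_Diff_UNIV card_Diff_singleton of_nat_diff)
  finally have "shifted_frobenius a \<le> int (?q - 1) * int A + (int CARD('n) - 1) * int A"
    using bound by linarith
  also have "\<dots> = ((int ?q - 1) + (int CARD('n) - 1)) * int A"
    using q by (simp add: of_nat_diff algebra_simps)
  also have "\<dots> \<le> ((int CARD('n) - 1) * int ?q) * int A"
  proof (rule mult_right_mono)
    have "CARD('n) > 1" using False by (metis One_nat_def less_one linorder_neqE_nat not_gr0 zero_less_card_finite)
    then have "(int ?q - 1) * (int CARD('n) - 2) \<ge> 0"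
      using q by (intro mult_nonneg_nonneg) auto
    then show "int ?q - 1 + (int CARD('n) - 1) \<le> (int CARD('n) - 1) * int ?q"
      by (simp add: algebra_simps)
  qed simp
  finally show ?thesis .
qed

subsection \<open>Averages of exponential sums\<close>

lemma sin_ge_chord:
  fixes x :: real
  assumes "0 \<le> x" "x \<le> pi / 2"
  shows "2 * x / pi \<le> sin x"
proof -
  have "concave_on {0..pi} (sin :: real \<Rightarrow> real)"
    by (rule f''_le0_imp_concave[where f' = cos and f'' = "\<lambda>x. - sin x"])
      (auto intro!: derivative_eq_intros sin_ge_zero)
  then have "(1 - 2 * x / pi) * sin 0 + (2 * x / pi) * sin (pi / 2)
      \<le> sin ((1 - 2 * x / pi) *\<^sub>R 0 + (2 * x / pi) *\<^sub>R (pi / 2))"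
    by (rule concave_onD) (use assms in \<open>auto simp: field_simps\<close>)
  then show ?thesis by simp
qed

lemma expsum_ratio_add_of_int: "expsum_ratio N (t + of_int z) = expsum_ratio N t"
proof -
  have "cis (2 * pi * real n * (t + of_int z)) = cis (2 * pi * real n * t) * cis (2 * pi * of_int (int n * z))" for n
    by (simp add: cis_mult algebra_simps)
  then show ?thesis
    by (simp only: expsum_ratio_def cis_eq_1_of_int mult_1_right)
qed

lemma expsum_ratio_mod:
  assumes "q > 0"
  shows "expsum_ratio N (real j / real q) = expsum_ratio N (real (j mod q) / real q)"
proof -
  have "real j = real (j mod q) + real q * real (j div q)"
    by (metis mod_mult_div_eq of_nat_add of_nat_mult)
  then have "real j / real q = real (j mod q) / real q + of_int (int (j div q))"
    using assms by (simp add: field_simps)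
  then show ?thesis
    by (simp only: expsum_ratio_add_of_int)
qed

text \<open>The geometric series is at most \<open>2 / norm (w - 1)\<close>, and
  \<open>norm (w - 1) = 2 * \<bar>sin (pi * t)\<bar>\<close> is at least four times the distance
  from \<open>t\<close> to the nearest integer, by concavity of the sine.\<close>

lemma expsum_ratio_le_inverse:
  assumes "0 < r" "r < q" "N > 0"
  shows "expsum_ratio N (real r / real q) \<le> real q / (2 * real N * real (min r (q - r)))"
proof -
  define t where "t = real r / real q"
  define w where "w = cis (2 * pi * t)"
  have t: "0 < t" "t < 1" using assms by (auto simp: t_def)
  have sin_t: "sin (pi * t) \<ge> 2 * real (min r (q - r)) / real q"
  proof (cases "t \<le> 1 / 2")
    case True
    have "2 * real (min r (q - r)) / real q \<le> 2 * (pi * t) / pi"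
      using assms by (auto simp: t_def divide_right_mono)
    also have "\<dots> \<le> sin (pi * t)"
      using t True by (intro sin_ge_chord) auto
    finally show ?thesis .
  next
    case False
    have "2 * real (min r (q - r)) / real q \<le> 2 * (pi * (1 - t)) / pi"
      using assms by (auto simp: t_def field_simps of_nat_diff min_def)
    also have "\<dots> \<le> sin (pi * (1 - t))"
      using t False by (intro sin_ge_chord) (auto simp: algebra_simps)
    also have "pi * (1 - t) = pi - pi * t" by (simp add: algebra_simps)
    finally show ?thesis by simp
  qed
  have min_pos: "real (min r (q - r)) > 0" using assms by auto
  have "norm (w - 1) = 2 * \<bar>sin (pi * t)\<bar>"
    using dist_exp_i_1[of "2 * pi * t"] by (simp add: w_def cis_conv_exp)
  then have w: "norm (w - 1) \<ge> 4 * real (min r (q - r)) / real q"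
    using sin_t by linarith
  then have w1: "norm (w - 1) > 0"
    using min_pos assms by (smt (verit) divide_pos_pos of_nat_0_less_iff less_trans)
  have "(\<Sum>n<N. cis (2 * pi * real n * t)) = (\<Sum>n<N. w ^ n)"
    unfolding w_def by (subst Complex.DeMoivre) (simp add: algebra_simps)
  also have "\<dots> = (w ^ N - 1) / (w - 1)"
    using w1 by (intro geometric_sum) auto
  finally have "norm (\<Sum>n<N. cis (2 * pi * real n * t)) = norm (w ^ N - 1) / norm (w - 1)"
    by (simp add: norm_divide)
  also have "\<dots> \<le> 2 / (4 * real (min r (q - r)) / real q)"
  proof (rule frac_le)
    have "norm (w ^ N - 1) \<le> norm (w ^ N) + norm (1 :: complex)"
      by (rule norm_triangle_ineq4)
    then show "norm (w ^ N - 1) \<le> 2"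
      by (simp add: norm_power w_def)
  qed (use w min_pos assms in auto)
  finally show ?thesis
    unfolding expsum_ratio_def t_def[symmetric] using assms min_pos
    by (simp add: divide_simps mult_ac)
qed

lemma sum_min_1_inverse_square_le:
  assumes "y > (0 :: real)"
  shows "(\<Sum>r\<in>{1..<m}. min 1 ((y / real r)\<^sup>2)) \<le> 4 * y"
proof -
  \<comment> \<open>Both entries of the minimum lead to the bound
    \<open>4 * y\<^sup>2 / (y + r)\<^sup>2\<close>, because \<open>y + r \<le> 2 * max y r\<close>;
    replacing one factor by \<open>y + (r - 1)\<close> makes it a difference of
    \<open>\<phi>\<close>.\<close>
  define \<phi> where "\<phi> r = - 4 * y\<^sup>2 / (y + real r)" for r
  have "min 1 ((y / real r)\<^sup>2) \<le> \<phi> r - \<phi> (r - 1)" if r: "r \<ge> 1" for r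
  proof -
    have pos: "y + real r > 0" "y + real (r - 1) > 0" using assms r by auto
    have "min 1 ((y / real r)\<^sup>2) \<le> 4 * y\<^sup>2 / (y + real r)\<^sup>2"
    proof (cases "real r \<le> y")
      case True
      then have "(y + real r)\<^sup>2 \<le> (2 * y)\<^sup>2" using assms by (intro power_mono) auto
      then have "1 \<le> 4 * y\<^sup>2 / (y + real r)\<^sup>2"
        using pos by (simp add: field_simps)
      then show ?thesis by linarith
    next
      case False
      then have "(y + real r)\<^sup>2 \<le> (2 * real r)\<^sup>2" using assms by (intro power_mono) auto
      then have "4 * y\<^sup>2 / (2 * real r)\<^sup>2 \<le> 4 * y\<^sup>2 / (y + real r)\<^sup>2"
        using pos r by (intro divide_left_mono) auto
      then have "(y / real r)\<^sup>2 \<le> 4 * y\<^sup>2 / (y + real r)\<^sup>2"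
        by (simp add: power_divide power_mult_distrib)
      then show ?thesis by linarith
    qed
    also have "\<dots> \<le> 4 * y\<^sup>2 / ((y + real r) * (y + real (r - 1)))"
      using pos r by (intro divide_left_mono) (auto simp: power2_eq_square)
    also have "\<dots> = \<phi> r - \<phi> (r - 1)"
      using pos r by (simp add: \<phi>_def field_simps of_nat_diff)
    finally show ?thesis .
  qed
  then have "(\<Sum>r\<in>{1..<m}. min 1 ((y / real r)\<^sup>2)) \<le> (\<Sum>r\<in>{1..<m}. \<phi> r - \<phi> (r - 1))"
    by (intro sum_mono) auto
  also have "\<dots> \<le> \<phi> (m - 1) - \<phi> 0"
  proof (induction m)
    case (Suc m)
    then show ?case by (cases m) auto
  qed simp
  also have "\<dots> \<le> - \<phi> 0"
    using assms by (simp add: \<phi>_def)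
  also have "\<dots> = 4 * y"
    using assms by (simp add: \<phi>_def power2_eq_square)
  finally show ?thesis .
qed

lemma sum_reflect_le:
  fixes h :: "nat \<Rightarrow> real"
  assumes "\<And>r. 0 \<le> h r"
  shows "(\<Sum>r\<in>{1..<q}. h (min r (q - r))) \<le> 2 * (\<Sum>r\<in>{1..<q}. h r)"
proof -
  have "(\<Sum>r\<in>{1..<q}. h (min r (q - r))) \<le> (\<Sum>r\<in>{1..<q}. h r + h (q - r))"
    using assms by (intro sum_mono) (auto simp: min_def)
  also have "\<dots> = (\<Sum>r\<in>{1..<q}. h r) + (\<Sum>r\<in>{1..<q}. h (q - r))"
    by (rule sum.distrib)
  also have "(\<Sum>r\<in>{1..<q}. h (q - r)) = (\<Sum>r\<in>{1..<q}. h r)"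
    by (rule sum.reindex_bij_witness[of _ "\<lambda>r. q - r" "\<lambda>r. q - r"]) auto
  finally show ?thesis by simp
qed

lemma sum_expsum_ratio_power_le:
  assumes N: "N > 0" and l: "l \<ge> 2"
  shows "(\<Sum>r\<in>{1..<q}. expsum_ratio N (real r / real q) ^ l) \<le> 4 * real q / real N"
proof (cases "q = 0")
  case False
  \<comment> \<open>The pointwise bound is \<open>y / min r (q - r)\<close>; where the minimum is
    below \<open>y\<close>, the trivial bound 1 is better.\<close>
  define y where "y = real q / (2 * real N)"
  have y: "y > 0" using False N by (simp add: y_def)
  have "(\<Sum>r\<in>{1..<q}. expsum_ratio N (real r / real q) ^ l)
      \<le> (\<Sum>r\<in>{1..<q}. min 1 ((y / real (min r (q - r)))\<^sup>2))"
  proof (rule sum_mono)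
    fix r assume r: "r \<in> {1..<q}"
    let ?e = "expsum_ratio N (real r / real q)"
    have "?e ^ l \<le> ?e ^ 2"
      using l by (intro power_decreasing expsum_ratio_nonneg expsum_ratio_le_1)
    moreover have "?e ^ 2 \<le> (y / real (min r (q - r)))\<^sup>2"
      using expsum_ratio_le_inverse[of r q N] r N
      by (intro power_mono expsum_ratio_nonneg) (auto simp: y_def mult_ac)
    moreover have "?e ^ 2 \<le> 1"
      by (intro power_le_one expsum_ratio_nonneg expsum_ratio_le_1)
    ultimately show "?e ^ l \<le> min 1 ((y / real (min r (q - r)))\<^sup>2)"
      by linarith
  qed
  also have "\<dots> \<le> 2 * (\<Sum>r\<in>{1..<q}. min 1 ((y / real r)\<^sup>2))"
    by (rule sum_reflect_le) simp
  also have "\<dots> \<le> 2 * (4 * y)"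
    by (intro mult_left_mono sum_min_1_inverse_square_le y) simp
  finally show ?thesis by (simp add: y_def)
qed simp

text \<open>For \<open>q\<close> well below \<open>N\<close> this improves on the preceding bound:
  the pointwise estimate, raised to the power \<open>l\<close>, puts the full factor
  \<open>(q / N) ^ l\<close> in front of a convergent series.\<close>

lemma sum_expsum_ratio_power_le':
  assumes N: "N > 0" and l: "l \<ge> 2"
  shows "(\<Sum>r\<in>{1..<q}. expsum_ratio N (real r / real q) ^ l) \<le> 8 * (real q / real N) ^ l"
proof -
  have "(\<Sum>r\<in>{1..<q}. expsum_ratio N (real r / real q) ^ l)
      \<le> (\<Sum>r\<in>{1..<q}. (real q / real N) ^ l * min 1 ((1 / real (min r (q - r)))\<^sup>2))"
  proof (rule sum_mono)
    fix r assume r: "r \<in> {1..<q}"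
    define s where "s = min r (q - r)"
    have s: "real s \<ge> 1" using r by (auto simp: s_def)
    have "expsum_ratio N (real r / real q) \<le> real q / (2 * real N * real s)"
      using expsum_ratio_le_inverse[of r q N] r N by (simp add: s_def)
    also have "\<dots> \<le> real q / real N * (1 / real s)"
      using N s by (simp add: field_simps)
    finally have "expsum_ratio N (real r / real q) ^ l \<le> (real q / real N * (1 / real s)) ^ l"
      by (intro power_mono expsum_ratio_nonneg)
    also have "\<dots> = (real q / real N) ^ l * (1 / real s) ^ l"
      by (rule power_mult_distrib)
    also have "\<dots> \<le> (real q / real N) ^ l * (1 / real s) ^ 2"
      using s l by (intro mult_left_mono power_decreasing) auto
    also have "(1 / real s) ^ 2 = min 1 ((1 / real s)\<^sup>2)"
      using s by (simp add: min_absorb2 power_le_one)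
    finally show "expsum_ratio N (real r / real q) ^ l
        \<le> (real q / real N) ^ l * min 1 ((1 / real (min r (q - r)))\<^sup>2)"
      by (simp add: s_def)
  qed
  also have "\<dots> = (real q / real N) ^ l * (\<Sum>r\<in>{1..<q}. min 1 ((1 / real (min r (q - r)))\<^sup>2))"
    by (simp add: sum_distrib_left)
  also have "\<dots> \<le> (real q / real N) ^ l * (2 * (\<Sum>r\<in>{1..<q}. min 1 ((1 / real r)\<^sup>2)))"
    by (intro mult_left_mono sum_reflect_le) auto
  also have "\<dots> \<le> (real q / real N) ^ l * (2 * (4 * 1))"
    by (intro mult_left_mono sum_min_1_inverse_square_le) auto
  finally show ?thesis by simp
qed

text \<open>Multiplication by \<open>b\<close> permutes the residues in each block of length
  \<open>q\<close>, and \<open>T div q + 1\<close> blocks cover \<open>{1..T}\<close>;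
  \<open>q \<le> T\<close> bounds their number by \<open>2 * T / q\<close>.\<close>

lemma sum_periodic_le:
  fixes h :: "nat \<Rightarrow> real"
  assumes q: "0 < q" "q \<le> T" and b: "coprime b q" and h: "\<And>r. 0 \<le> h r"
  shows "(\<Sum>a\<in>{1..T}. h (b * a mod q)) \<le> 2 * real T / real q * (\<Sum>r<q. h r)"
proof -
  have block: "(\<Sum>a\<in>{c..<c + q}. h (b * a mod q)) = (\<Sum>r<q. h r)" for c
  proof (rule sum.reindex_bij_betw)
    have "inj_on (\<lambda>a. b * a mod q) {c..<c + q}"
    proof (rule linorder_inj_onI)
      fix x y assume xy: "x < y" "x \<in> {c..<c + q}" "y \<in> {c..<c + q}"
      show "b * x mod q \<noteq> b * y mod q"
      proof
        assume "b * x mod q = b * y mod q"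
        then have "q dvd b * y - b * x"
          using mod_eq_dvd_iff_nat[of "b * x" "b * y" q] xy(1) by (metis less_imp_le mult_le_mono2)
        then have "q dvd b * (y - x)"
          by (simp add: diff_mult_distrib2)
        then have "q dvd y - x"
          using b by (metis coprime_commute coprime_dvd_mult_right_iff)
        then show False
          using xy by (auto dest: dvd_imp_le)
      qed
    qed auto
    moreover have "(\<lambda>a. b * a mod q) ` {c..<c + q} \<subseteq> {..<q}"
      using q by auto
    ultimately show "bij_betw (\<lambda>a. b * a mod q) {c..<c + q} {..<q}"
      by (simp add: bij_betw_def card_image card_subset_eq)
  qed
  have blocks: "(\<Sum>a\<in>{1..<1 + m * q}. h (b * a mod q)) = real m * (\<Sum>r<q. h r)" for m
  proof (induction m)
    case (Suc m)
    have "{1..<1 + Suc m * q} = {1..<1 + m * q} \<union> {1 + m * q..<1 + m * q + q}" by auto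
    then have "(\<Sum>a\<in>{1..<1 + Suc m * q}. h (b * a mod q)) = (\<Sum>a\<in>{1..<1 + m * q}. h (b * a mod q))
        + (\<Sum>a\<in>{1 + m * q..<1 + m * q + q}. h (b * a mod q))"
      by (simp only:) (rule sum.union_disjoint, auto)
    then show ?case
      by (simp only: Suc block) (simp add: algebra_simps)
  qed simp
  define m where "m = T div q + 1"
  have "T < 1 + m * q"
    using q by (simp add: m_def) (metis add.commute dividend_less_div_times less_Suc_eq mult.commute)
  then have "(\<Sum>a\<in>{1..T}. h (b * a mod q)) \<le> (\<Sum>a\<in>{1..<1 + m * q}. h (b * a mod q))"
    by (intro sum_mono2 h) auto
  also have "\<dots> = real m * (\<Sum>r<q. h r)" by (rule blocks)
  also have "\<dots> \<le> 2 * real T / real q * (\<Sum>r<q. h r)"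
  proof (intro mult_right_mono sum_nonneg h)
    have "real (T div q) \<le> real T / real q" by (rule of_nat_div_le_of_nat)
    moreover have "1 \<le> real T / real q" using q by simp
    ultimately show "real m \<le> 2 * real T / real q" by (simp add: m_def)
  qed
  finally show ?thesis .
qed

text \<open>Up to constants the multiples of \<open>q\<close> contribute \<open>T / q\<close> and
  the other residues \<open>T / N\<close>.\<close>

lemma sum_expsum_ratio_range_le:
  assumes "0 < q" "q \<le> T" and b: "coprime b q" and N: "N > 0" and l: "l \<ge> 2"
  shows "(\<Sum>a\<in>{1..T}. expsum_ratio N (real (b * a) / real q) ^ l) \<le> 10 * real T / real (min N q)"
proof -
  let ?h = "\<lambda>r. expsum_ratio N (real r / real q) ^ l"
  have "(\<Sum>a\<in>{1..T}. expsum_ratio N (real (b * a) / real q) ^ l) = (\<Sum>a\<in>{1..T}. ?h (b * a mod q))"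
    using expsum_ratio_mod[OF assms(1)] by (intro sum.cong) (simp_all add: flip: of_nat_mult)
  also have "\<dots> \<le> 2 * real T / real q * (\<Sum>r<q. ?h r)"
    by (intro sum_periodic_le assms zero_le_power expsum_ratio_nonneg)
  also have "\<dots> \<le> 2 * real T / real q * (1 + 4 * real q / real N)"
  proof (rule mult_left_mono)
    have "(\<Sum>r<q. ?h r) = ?h 0 + (\<Sum>r\<in>{1..<q}. ?h r)"
    proof -
      have "{..<q} = insert 0 {1..<q}" using assms by auto
      then show ?thesis by simp
    qed
    also have "\<dots> \<le> 1 + 4 * real q / real N"
      by (intro add_mono sum_expsum_ratio_power_le N l power_le_one expsum_ratio_nonneg expsum_ratio_le_1)
    finally show "(\<Sum>r<q. ?h r) \<le> 1 + 4 * real q / real N" .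
  qed simp
  also have "\<dots> = 2 * real T / real q + 8 * real T / real N"
    using assms N by (simp add: field_simps)
  also have "\<dots> \<le> 2 * real T / real (min N q) + 8 * real T / real (min N q)"
    using assms N by (intro add_mono divide_left_mono) auto
  finally show ?thesis
    by (simp flip: add_divide_distrib)
qed

text \<open>Without the residue 0 the bound with the factor \<open>(q / N) ^ l\<close>
  applies.\<close>

lemma sum_expsum_ratio_nonmultiples_le:
  assumes "0 < q" "q \<le> T" and b: "coprime b q" and N: "N > 0" and l: "l \<ge> 2"
  shows "(\<Sum>a\<in>{a\<in>{1..T}. \<not> q dvd a}. expsum_ratio N (real (b * a) / real q) ^ l)
    \<le> 16 * real T / real q * (real q / real N) ^ l"
proof -
  let ?h = "\<lambda>r. if r = 0 then 0 else expsum_ratio N (real r / real q) ^ l"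
  have "(\<Sum>a\<in>{a\<in>{1..T}. \<not> q dvd a}. expsum_ratio N (real (b * a) / real q) ^ l)
      \<le> (\<Sum>a\<in>{a\<in>{1..T}. \<not> q dvd a}. ?h (b * a mod q))"
  proof (rule sum_mono)
    fix a assume "a \<in> {a\<in>{1..T}. \<not> q dvd a}"
    then have "\<not> q dvd b * a"
      using b by (simp add: coprime_dvd_mult_right_iff coprime_commute)
    then show "expsum_ratio N (real (b * a) / real q) ^ l \<le> ?h (b * a mod q)"
      using expsum_ratio_mod[OF assms(1), of N "b * a"] by (auto simp: dvd_eq_mod_eq_0)
  qed
  also have "\<dots> \<le> (\<Sum>a\<in>{1..T}. ?h (b * a mod q))"
    by (intro sum_mono2) (auto simp: expsum_ratio_nonneg)
  also have "\<dots> \<le> 2 * real T / real q * (\<Sum>r<q. ?h r)"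
    by (intro sum_periodic_le assms) (auto simp: expsum_ratio_nonneg)
  also have "(\<Sum>r<q. ?h r) = (\<Sum>r\<in>{1..<q}. expsum_ratio N (real r / real q) ^ l)"
    by (rule sum.mono_neutral_cong_right) auto
  also have "2 * real T / real q * \<dots> \<le> 2 * real T / real q * (8 * (real q / real N) ^ l)"
    by (intro mult_left_mono sum_expsum_ratio_power_le' N l) auto
  finally show ?thesis by simp
qed

section \<open>Averages over whole vectors and over all fractions\<close>

lemma sum_UNION_le:
  fixes h :: "'b \<Rightarrow> real"
  assumes "finite I" "\<And>i. i \<in> I \<Longrightarrow> finite (A i)" "\<And>x. 0 \<le> h x"
  shows "(\<Sum>x\<in>(\<Union>i\<in>I. A i). h x) \<le> (\<Sum>i\<in>I. \<Sum>x\<in>A i. h x)"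
  using assms(1,2)
proof (induction I rule: finite_induct)
  case (insert i I)
  have "(\<Sum>x\<in>(\<Union>i\<in>insert i I. A i). h x) \<le> (\<Sum>x\<in>A i. h x) + (\<Sum>x\<in>(\<Union>i\<in>I. A i). h x)"
    using sum.union_inter[of "A i" "\<Union>i\<in>I. A i" h] insert
      sum_nonneg[of "A i \<inter> (\<Union>i\<in>I. A i)" h] assms(3) by auto
  then show ?case
    using insert by force
qed simp

text \<open>Coordinate \<open>j\<close> carries the larger length \<open>N1\<close>. For
  \<open>q \<le> N0\<close> one saving \<open>(q / N0) ^ l\<close> offsets the factors
  \<open>1 / q\<close> of all \<open>l\<close> coordinates, since the exponent is their number. The
  larger \<open>N1\<close> helps only once \<open>q\<close> exceeds it, whence the case distinction
  in the bound.\<close>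

lemma sum_prod_expsum_ratio_le:
  fixes N :: "'i \<Rightarrow> nat"
  assumes I: "finite I" "card I \<ge> 2" "j \<in> I"
    and N: "0 < N0" "N0 \<le> N1" "N j = N1" "\<And>i. i \<in> I \<Longrightarrow> i \<noteq> j \<Longrightarrow> N i = N0"
    and q: "0 < q" "q \<le> T" "coprime b q"
  shows "(\<Sum>f\<in>{f \<in> I \<rightarrow>\<^sub>E {1..T}. \<exists>i\<in>I. \<not> q dvd f i}.
            \<Prod>i\<in>I. expsum_ratio (N i) (real (b * f i) / real q) ^ card I)
    \<le> real (card I) * (16 * real T) ^ card I / (real N0 ^ (card I - 1) * real (if q \<le> N1 then N0 else N1))"
    (is "?L \<le> _")
proof -
  define l where "l = card I"
  have l: "l \<ge> 2" using I by (simp add: l_def)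
  let ?e = "\<lambda>i a. expsum_ratio (N i) (real (b * a) / real q) ^ l"
  have e: "0 \<le> ?e i a" for i a by (simp add: expsum_ratio_nonneg)
  have NI: "N i \<ge> N0" "N i > 0" if "i \<in> I" for i
    using N that by (cases "i = j"; force)+
  have T: "T > 0" using q by simp
  have fin: "finite (I \<rightarrow>\<^sub>E {1..T})" using I by (intro finite_PiE) auto
  have full: "(\<Sum>a\<in>{1..T}. ?e i a) \<le> 10 * real T / real (min (N i) q)" if "i \<in> I" for i
    using sum_expsum_ratio_range_le[OF q NI(2)[OF that] l] .
  show ?thesis
  proof (cases "q \<le> N0")
    case True
    \<comment> \<open>A union bound over the coordinate that is not a multiple of \<open>q\<close>;
      it costs the factor \<open>card I\<close>.\<close>
    have "?L \<le> (\<Sum>f\<in>(\<Union>i0\<in>I. {f \<in> I \<rightarrow>\<^sub>E {1..T}. \<not> q dvd f i0}). \<Prod>i\<in>I. ?e i (f i))"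
      unfolding l_def[symmetric] using fin e I(1) by (intro sum_mono2 prod_nonneg) auto
    also have "\<dots> \<le> (\<Sum>i0\<in>I. \<Sum>f\<in>{f \<in> I \<rightarrow>\<^sub>E {1..T}. \<not> q dvd f i0}. \<Prod>i\<in>I. ?e i (f i))"
      using fin e I(1) by (intro sum_UNION_le prod_nonneg) (auto intro: finite_subset[OF _ fin])
    also have "\<dots> \<le> (\<Sum>i0\<in>I. (16 * real T / real q) ^ l * (real q / real N0) ^ l)"
    proof (rule sum_mono)
      fix i0 assume i0: "i0 \<in> I"
      let ?B = "\<lambda>i. if i = i0 then {a \<in> {1..T}. \<not> q dvd a} else {1..T}"
      have "{f \<in> I \<rightarrow>\<^sub>E {1..T}. \<not> q dvd f i0} = Pi\<^sub>E I ?B"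
        using i0 by (auto simp: PiE_iff extensional_def split: if_splits)
      then have "(\<Sum>f\<in>{f \<in> I \<rightarrow>\<^sub>E {1..T}. \<not> q dvd f i0}. \<Prod>i\<in>I. ?e i (f i)) = (\<Prod>i\<in>I. \<Sum>a\<in>?B i. ?e i a)"
        using I(1) by (subst prod_sum_PiE) auto
      also have "\<dots> \<le> (\<Prod>i\<in>I. (16 * real T / real q) * (if i = i0 then (real q / real N0) ^ l else 1))"
      proof (intro prod_mono conjI sum_nonneg e)
        fix i assume i: "i \<in> I"
        show "(\<Sum>a\<in>?B i. ?e i a) \<le> (16 * real T / real q) * (if i = i0 then (real q / real N0) ^ l else 1)"
        proof (cases "i = i0")
          case True
          have "(\<Sum>a\<in>{a \<in> {1..T}. \<not> q dvd a}. ?e i a) \<le> 16 * real T / real q * (real q / real (N i)) ^ l"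
            by (rule sum_expsum_ratio_nonmultiples_le[OF q NI(2)[OF i] l])
          also have "\<dots> \<le> 16 * real T / real q * (real q / real N0) ^ l"
            using NI[OF i] N by (intro mult_left_mono power_mono divide_left_mono) auto
          finally show ?thesis using True by simp
        next
          case False
          have "10 * real T / real (min (N i) q) \<le> 16 * real T / real q"
            using NI[OF i] \<open>q \<le> N0\<close> q by (simp add: min_absorb2 divide_right_mono)
          then show ?thesis
            using full[OF i] False by simp
        qed
      qed
      also have "\<dots> = (16 * real T / real q) ^ l * (real q / real N0) ^ l"
        using I(1) i0 by (subst prod.distrib) (simp add: l_def)
      finally show "(\<Sum>f\<in>{f \<in> I \<rightarrow>\<^sub>E {1..T}. \<not> q dvd f i0}. \<Prod>i\<in>I. ?e i (f i))
          \<le> (16 * real T / real q) ^ l * (real q / real N0) ^ l" .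
    qed
    also have "\<dots> = real l * (16 * real T) ^ l / real N0 ^ l"
      using q by (simp add: l_def power_divide)
    also have "real N0 ^ l = real N0 ^ (l - 1) * real (if q \<le> N1 then N0 else N1)"
      using True N l by (cases l) auto
    finally show ?thesis by (simp add: l_def)
  next
    case False
    \<comment> \<open>Now divisibility is ignored: up to constants each coordinate contributes
      \<open>T / min (N i) q\<close>, which is at most \<open>T / M\<close> for \<open>j\<close> and
      \<open>T / N0\<close> for the others.\<close>
    define M where "M = (if q \<le> N1 then N0 else N1)"
    have M: "M > 0" "M \<le> min N1 q" using N False by (auto simp: M_def)
    have "?L \<le> (\<Sum>f\<in>I \<rightarrow>\<^sub>E {1..T}. \<Prod>i\<in>I. ?e i (f i))"
      unfolding l_def[symmetric] using fin e by (intro sum_mono2 prod_nonneg) auto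
    also have "\<dots> = (\<Prod>i\<in>I. \<Sum>a\<in>{1..T}. ?e i a)"
      using I(1) by (subst prod_sum_PiE) auto
    also have "\<dots> \<le> (\<Prod>i\<in>I. (16 * real T / real N0) * (if i = j then real N0 / real M else 1))"
    proof (intro prod_mono conjI sum_nonneg e)
      fix i assume i: "i \<in> I"
      have "10 * real T / real (min (N i) q) \<le> 10 * real T / real (if i = j then M else N0)"
        using M N i False q by (intro divide_left_mono) (auto simp: min_def)
      also have "\<dots> \<le> 16 * real T / real (if i = j then M else N0)"
        by (intro divide_right_mono) auto
      also have "\<dots> = (16 * real T / real N0) * (if i = j then real N0 / real M else 1)"
        using N by simp
      finally show "(\<Sum>a\<in>{1..T}. ?e i a) \<le> (16 * real T / real N0) * (if i = j then real N0 / real M else 1)"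
        using full[OF i] by linarith
    qed
    also have "\<dots> = (16 * real T / real N0) ^ l * (real N0 / real M)"
      using I by (subst prod.distrib) (simp add: l_def)
    also have "\<dots> = (16 * real T) ^ l / (real N0 ^ (l - 1) * real M)"
      using N M l by (cases l) (auto simp: power_divide field_simps)
    also have "\<dots> \<le> real l * (16 * real T) ^ l / (real N0 ^ (l - 1) * real M)"
      using l mult_right_mono[of 1 "real l" "(16 * real T) ^ l"] by (intro divide_right_mono) auto
    finally show ?thesis by (simp add: l_def M_def)
  qed
qed

text \<open>A pair \<open>(q, k)\<close> with \<open>k / q = b / r\<close> in lowest terms is
  determined by \<open>b < r\<close> and \<open>gcd k q \<le> T div r\<close>, so each
  \<open>r\<close> arises at most \<open>T\<close> times; \<open>r \<ge> 2\<close> because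
  \<open>0 < k < q\<close>.\<close>

lemma sum_over_reduced_denominators_le:
  fixes h :: "nat \<Rightarrow> real"
  assumes h: "\<And>q. 0 \<le> h q"
  shows "(\<Sum>q\<in>{1..T}. \<Sum>k\<in>{1..<q}. h (q div gcd k q)) \<le> real T * (\<Sum>q\<in>{2..T}. h q)"
proof -
  let ?P = "SIGMA q:{1..T}. {1..<q}"
  let ?\<phi> = "\<lambda>(q, k). q div gcd k q"
  have fin: "finite ?P" by auto
  have im: "?\<phi> ` ?P \<subseteq> {2..T}"
  proof clarify
    fix q k assume qk: "q \<in> {1..T}" "k \<in> {1..<q}"
    have "q div gcd k q \<noteq> 0"
    proof -
      have "gcd k q \<le> q" using qk by (intro gcd_le2_nat) auto
      then show ?thesis using qk by (simp add: div_eq_0_iff not_less)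
    qed
    moreover have "q div gcd k q \<noteq> 1"
    proof
      assume "q div gcd k q = 1"
      then have "gcd k q = q" by (metis dvd_mult_div_cancel gcd_dvd2 mult_1_right)
      then have "q dvd k" by (metis gcd_dvd1)
      then show False using qk by (auto dest: dvd_imp_le)
    qed
    moreover have "q div gcd k q \<le> T"
      using qk by (intro le_trans[OF div_le_dividend]) auto
    ultimately show "q div gcd k q \<in> {2..T}" by auto
  qed
  have "(\<Sum>q\<in>{1..T}. \<Sum>k\<in>{1..<q}. h (q div gcd k q)) = (\<Sum>p\<in>?P. h (?\<phi> p))"
    by (subst sum.Sigma) (auto intro!: sum.cong)
  also have "\<dots> = (\<Sum>r\<in>{2..T}. \<Sum>p\<in>{p \<in> ?P. ?\<phi> p = r}. h (?\<phi> p))"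
    by (rule sum.group[symmetric]) (use fin im in auto)
  also have "\<dots> = (\<Sum>r\<in>{2..T}. real (card {p \<in> ?P. ?\<phi> p = r}) * h r)"
    by (intro sum.cong) auto
  also have "\<dots> \<le> (\<Sum>r\<in>{2..T}. real T * h r)"
  proof (intro sum_mono mult_right_mono h of_nat_mono)
    fix r assume r: "r \<in> {2..T}"
    have "card {p \<in> ?P. ?\<phi> p = r} \<le> card ({1..T div r} \<times> {1..<r})"
    proof (rule card_inj_on_le)
      let ?\<psi> = "\<lambda>(q, k). (gcd k q, k div gcd k q)"
      show "inj_on ?\<psi> {p \<in> ?P. ?\<phi> p = r}"
      proof (rule inj_onI)
        fix x y assume *: "x \<in> {p \<in> ?P. ?\<phi> p = r}" "y \<in> {p \<in> ?P. ?\<phi> p = r}" "?\<psi> x = ?\<psi> y"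
        obtain q k q' k' where xy: "x = (q, k)" "y = (q', k')" by (cases x, cases y)
        have "q = gcd k q * (q div gcd k q)" "q' = gcd k' q' * (q' div gcd k' q')"
          "k = gcd k q * (k div gcd k q)" "k' = gcd k' q' * (k' div gcd k' q')"
          by simp_all
        moreover have "q div gcd k q = q' div gcd k' q'" "gcd k q = gcd k' q'" "k div gcd k q = k' div gcd k' q'"
          using * unfolding xy by auto
        ultimately show "x = y" unfolding xy by metis
      qed
      show "?\<psi> ` {p \<in> ?P. ?\<phi> p = r} \<subseteq> {1..T div r} \<times> {1..<r}"
      proof (rule image_subsetI)
        fix p assume "p \<in> {p \<in> ?P. ?\<phi> p = r}"
        then obtain q k where p: "p = (q, k)" and qk: "q \<le> T" "0 < k" "k < q" "r = q div gcd k q"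
          by (auto simp: Suc_le_eq)
        define g b where "g = gcd k q" and "b = k div g"
        have g: "g > 0" "q = g * r" "k = g * b" using qk by (auto simp: g_def b_def)
        have "g \<le> T div r"
          using qk(1) r unfolding g(2) by (simp add: less_eq_div_iff_mult_less_eq)
        moreover have "b > 0" using g(3) qk(2) by (cases b) auto
        moreover have "b < r" using qk(3) g(1) unfolding g(2,3) by simp
        ultimately show "?\<psi> p \<in> {1..T div r} \<times> {1..<r}"
          using g(1) by (simp add: p Suc_le_eq flip: g_def b_def)
      qed
    qed auto
    also have "\<dots> = (T div r) * (r - 1)" by simp
    also have "\<dots> \<le> (T div r) * r" by (intro mult_left_mono) auto
    also have "\<dots> \<le> T" by simp
    finally show "card {p \<in> ?P. ?\<phi> p = r} \<le> T" .
  qed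
  finally show ?thesis by (simp add: sum_distrib_left)
qed

text \<open>Markov's inequality: the cardinality is at most the sum over the set of a quantity that
  is at least 1 there. Grouping by \<open>q = a $ m\<close> and reducing \<open>k / q\<close> leaves
  averages over the other coordinates.\<close>

lemma card_large_expsums_le:
  fixes j m :: "'n::finite" and N :: "'n \<Rightarrow> nat"
  defines "l \<equiv> CARD('n) - 1"
  assumes d: "CARD('n) \<ge> 3" and jm: "j \<noteq> m"
    and N: "0 < N0" "N0 \<le> N1" "N j = N1" "\<And>i. i \<noteq> j \<Longrightarrow> N i = N0"
  shows "real (card {a \<in> primitive_vectors. (\<forall>i. a $ i \<le> T) \<and>
           1 \<le> (\<Sum>k\<in>{1..<a $ m}. \<Prod>i\<in>- {m}. expsum_ratio (N i) (real k * real (a $ i) / real (a $ m)) ^ l)})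
     \<le> real l * 16 ^ l * real T ^ (l + 1) * (real N1 / real N0 ^ l + real T / (real N0 ^ (l - 1) * real N1))"
    (is "real (card ?Bad) \<le> _")
proof -
  define B where "B = ?Bad"
  let ?I = "- {m}"
  have I: "finite ?I" "card ?I = l" "j \<in> ?I" "l \<ge> 2"
    using d jm by (auto simp: l_def Compl_eq_Diff_UNIV card_Diff_singleton)
  have prim: "a \<in> primitive_vectors" and le: "a $ i \<le> T"
    and large: "1 \<le> (\<Sum>k\<in>{1..<a $ m}. \<Prod>i\<in>?I. expsum_ratio (N i) (real k * real (a $ i) / real (a $ m)) ^ l)"
    if "a \<in> B" for a i
    using that unfolding B_def by blast+
  have pos: "0 < a $ i" if "a \<in> B" for a i
    by (rule primitive_vectorsD(1)[OF prim[OF that]])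
  have fin: "finite B"
    by (rule finite_subset[OF _ finite_vec[of "\<lambda>_. {..T}"]]) (use le in auto)
  let ?E = "\<lambda>b q f. \<Prod>i\<in>?I. expsum_ratio (N i) (real (b * f i) / real q) ^ l"
  define H where "H q = real l * (16 * real T) ^ l / (real N0 ^ (l - 1) * real (if q \<le> N1 then N0 else N1))" for q
  have inner: "(\<Sum>a\<in>{a\<in>B. a $ m = q}. ?E k q (vec_nth a)) \<le> H (q div gcd k q)"
    if q: "q \<in> {1..T}" and k: "k \<in> {1..<q}" for q k
  proof -
    define g r b where "g = gcd k q" and "r = q div g" and "b = k div g"
    have g: "g > 0" "q = g * r" "k = g * b" using q by (auto simp: g_def r_def b_def)
    have "r \<noteq> 0"
      by (rule notI) (use q g(2) in simp)
    have "r \<le> q"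
      by (simp add: r_def)
    then have r: "0 < r" "r \<le> T"
      using \<open>r \<noteq> 0\<close> q by auto
    have br: "coprime b r"
      unfolding b_def r_def g_def using q by (intro div_gcd_coprime) auto
    have "r \<noteq> 1"
    proof
      assume "r = 1"
      then have "q dvd k" using g(2,3) by (metis dvd_triv_left mult_1_right)
      then show False using k by (auto dest: dvd_imp_le)
    qed
    let ?F = "{f \<in> ?I \<rightarrow>\<^sub>E {1..T}. \<exists>i\<in>?I. \<not> r dvd f i}"
    have E_eq: "?E k q f = ?E b r f" for f
      unfolding g(2,3) using g(1) by (intro prod.cong) simp_all
    let ?\<rho> = "\<lambda>a. restrict (vec_nth a) ?I"
    have inj: "inj_on ?\<rho> {a\<in>B. a $ m = q}"
    proof (rule inj_onI)
      fix a c assume ac: "a \<in> {a\<in>B. a $ m = q}" "c \<in> {a\<in>B. a $ m = q}" "?\<rho> a = ?\<rho> c"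
      have "a $ i = c $ i" for i
      proof (cases "i = m")
        case False
        then show ?thesis using fun_cong[OF ac(3), of i] by simp
      qed (use ac in simp)
      then show "a = c" by (simp add: vec_eq_iff)
    qed
    have im: "?\<rho> ` {a\<in>B. a $ m = q} \<subseteq> ?F"
    proof (rule image_subsetI)
      fix a assume "a \<in> {a\<in>B. a $ m = q}"
      then have a: "a \<in> B" "a \<in> primitive_vectors" "q = a $ m"
        using prim by auto
      \<comment> \<open>\<open>r\<close> divides \<open>q = a $ m\<close>; if it divided the other
        coordinates too, it would be a common divisor other than 1.\<close>
      have "\<exists>i\<in>?I. \<not> r dvd a $ i"
      proof (rule ccontr)
        assume "\<not> (\<exists>i\<in>?I. \<not> r dvd a $ i)"
        then have "r dvd a $ i" for i
          using g(2) a(3) by (cases "i = m") auto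
        then show False using primitive_vectorsD(2)[OF a(2)] \<open>r \<noteq> 1\<close> by blast
      qed
      then show "?\<rho> a \<in> ?F"
        using pos[OF a(1)] le[OF a(1)] by (auto simp: Suc_le_eq)
    qed
    have "(\<Sum>a\<in>{a\<in>B. a $ m = q}. ?E k q (vec_nth a)) = (\<Sum>a\<in>{a\<in>B. a $ m = q}. ?E b r (?\<rho> a))"
      unfolding E_eq by (intro sum.cong prod.cong) auto
    also have "\<dots> = (\<Sum>f\<in>?\<rho> ` {a\<in>B. a $ m = q}. ?E b r f)"
      by (subst sum.reindex[OF inj]) (simp only: o_def)
    also have "\<dots> \<le> (\<Sum>f\<in>?F. ?E b r f)"
    proof (rule sum_mono2)
      show "finite ?F" by (rule finite_subset[of _ "?I \<rightarrow>\<^sub>E {1..T}"]) (auto intro: finite_PiE)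
    qed (rule im, intro prod_nonneg ballI zero_le_power expsum_ratio_nonneg)
    also have "\<dots> \<le> H r"
      using sum_prod_expsum_ratio_le[of ?I j N0 N1 N r T b] I N r br by (simp add: H_def)
    finally show ?thesis by (simp add: r_def g_def)
  qed
  have "real (card B) = (\<Sum>a\<in>B. 1)" by simp
  also have "\<dots> \<le> (\<Sum>a\<in>B. \<Sum>k\<in>{1..<a $ m}. ?E k (a $ m) (vec_nth a))"
    by (intro sum_mono) (use large in simp)
  also have "\<dots> = (\<Sum>q\<in>{1..T}. \<Sum>a\<in>{a\<in>B. a $ m = q}. \<Sum>k\<in>{1..<a $ m}. ?E k (a $ m) (vec_nth a))"
  proof (rule sum.group[symmetric, OF fin])
    show "(\<lambda>a. a $ m) ` B \<subseteq> {1..T}"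
      using pos le by (auto simp: Suc_le_eq)
  qed simp
  also have "\<dots> = (\<Sum>q\<in>{1..T}. \<Sum>k\<in>{1..<q}. \<Sum>a\<in>{a\<in>B. a $ m = q}. ?E k q (vec_nth a))"
  proof (rule sum.cong[OF refl])
    fix q
    show "(\<Sum>a\<in>{a\<in>B. a $ m = q}. \<Sum>k\<in>{1..<a $ m}. ?E k (a $ m) (vec_nth a))
        = (\<Sum>k\<in>{1..<q}. \<Sum>a\<in>{a\<in>B. a $ m = q}. ?E k q (vec_nth a))"
      by (subst sum.swap) (intro sum.cong, auto)
  qed
  also have "\<dots> \<le> (\<Sum>q\<in>{1..T}. \<Sum>k\<in>{1..<q}. H (q div gcd k q))"
    by (intro sum_mono inner)
  also have "\<dots> \<le> real T * (\<Sum>q\<in>{2..T}. H q)"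
    by (intro sum_over_reduced_denominators_le) (simp add: H_def)
  \<comment> \<open>At most \<open>N1\<close> denominators need the weaker bound, and the stronger
    one is charged for all of the at most \<open>T\<close> denominators: these are the two terms of
    the estimate.\<close>
  also have "real T * (\<Sum>q\<in>{2..T}. H q) \<le> real T * (\<Sum>q\<in>{2..T}. real l * (16 * real T) ^ l *
      ((if q \<in> {1..N1} then 1 / real N0 ^ l else 0) + 1 / (real N0 ^ (l - 1) * real N1)))"
  proof (intro mult_left_mono sum_mono)
    fix q assume "q \<in> {2..T}"
    then have "1 / (real N0 ^ (l - 1) * real (if q \<le> N1 then N0 else N1))
        \<le> (if q \<in> {1..N1} then 1 / real N0 ^ l else 0) + 1 / (real N0 ^ (l - 1) * real N1)"
      using I(4) N(1) by (cases l) (auto simp: mult.commute)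
    from mult_left_mono[OF this, of "real l * (16 * real T) ^ l"]
    show "H q \<le> real l * (16 * real T) ^ l *
      ((if q \<in> {1..N1} then 1 / real N0 ^ l else 0) + 1 / (real N0 ^ (l - 1) * real N1))"
      by (simp add: H_def)
  qed simp
  also have "\<dots> = real T * (real l * (16 * real T) ^ l *
      ((\<Sum>q\<in>{2..T}. if q \<in> {1..N1} then 1 / real N0 ^ l else 0)
        + (\<Sum>q\<in>{2..T}. 1 / (real N0 ^ (l - 1) * real N1))))"
    by (simp only: sum_distrib_left[symmetric] sum.distrib)
  also have "\<dots> \<le> real T * (real l * (16 * real T) ^ l *
      (real N1 / real N0 ^ l + real T / (real N0 ^ (l - 1) * real N1)))"
  proof (intro mult_left_mono add_mono)
    have "(\<Sum>q\<in>{2..T}. if q \<in> {1..N1} then 1 / real N0 ^ l else 0)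
        = (\<Sum>q\<in>{2..T} \<inter> {1..N1}. 1 / real N0 ^ l)"
      by (subst sum.inter_restrict) auto
    also have "\<dots> \<le> (\<Sum>q\<in>{1..N1}. 1 / real N0 ^ l)"
      by (intro sum_mono2) auto
    finally show "(\<Sum>q\<in>{2..T}. if q \<in> {1..N1} then 1 / real N0 ^ l else 0) \<le> real N1 / real N0 ^ l"
      by simp
    have "(\<Sum>q\<in>{2..T}. 1 / (real N0 ^ (l - 1) * real N1)) = real (T - 1) * (1 / (real N0 ^ (l - 1) * real N1))"
      by simp
    also have "\<dots> \<le> real T * (1 / (real N0 ^ (l - 1) * real N1))"
      by (intro mult_right_mono) auto
    finally show "(\<Sum>q\<in>{2..T}. 1 / (real N0 ^ (l - 1) * real N1)) \<le> real T / (real N0 ^ (l - 1) * real N1)"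
      by simp
  qed auto
  also have "\<dots> = real l * 16 ^ l * real T ^ (l + 1) * (real N1 / real N0 ^ l + real T / (real N0 ^ (l - 1) * real N1))"
    by (simp add: power_mult_distrib algebra_simps)
  finally show ?thesis by (simp only: B_def)
qed

subsection \<open>Large Frobenius numbers are rare\<close>

lemma sum_powr_le:
  fixes s :: real
  assumes s: "0 < s" "s < 1"
  shows "(\<Sum>x\<in>{1..n}. real x powr (s - 1)) \<le> real n powr s / s"
proof (induction n)
  case (Suc n)
  have "s * real (Suc n) powr (s - 1) \<le> real (Suc n) powr s - real n powr s"
  proof (cases "n = 0")
    case False
    have "\<exists>z. real n < z \<and> z < real (Suc n) \<and>
        real (Suc n) powr s - real n powr s = (real (Suc n) - real n) * (s * z powr (s - 1))"
      using False by (intro MVT2) (auto intro!: derivative_eq_intros)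
    then obtain z where z: "real n < z" "z < real (Suc n)"
      "real (Suc n) powr s - real n powr s = s * z powr (s - 1)" by auto
    have "real (Suc n) powr (s - 1) \<le> z powr (s - 1)"
      using z False s by (intro powr_mono2') auto
    then show ?thesis using z s by simp
  qed (use s in simp)
  then have "real (Suc n) powr (s - 1) \<le> (real (Suc n) powr s - real n powr s) / s"
    using s by (simp add: field_simps)
  with Suc show ?case by (simp add: diff_divide_distrib)
qed simp

text \<open>Rankin's trick: the indicator of a product at most \<open>K\<close> is bounded by
  \<open>(K / product) powr (1 - s)\<close>, which factorises over the coordinates. A loss of
  \<open>P powr - s\<close> replaces the logarithms of a direct count.\<close>

lemma card_small_product_le:
  fixes s P :: real
  assumes s: "0 < s" "s < 1" and P: "P > 0"
  shows "real (card {a :: nat ^ 'n::finite. (\<forall>i. a $ i \<in> {1..T}) \<and> real (\<Prod>i\<in>UNIV. a $ i) \<le> P * real T ^ CARD('n)})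
    \<le> P powr (1 - s) * real T ^ CARD('n) / s ^ CARD('n)" (is "real (card ?S) \<le> _")
proof (cases "T = 0")
  case True
  then have "?S = {}" by auto
  then show ?thesis using s by (simp only: card.empty) simp
next
  case False
  define K where "K = P * real T ^ CARD('n)"
  let ?A = "{a :: nat ^ 'n. \<forall>i. a $ i \<in> {1..T}}"
  have K: "K > 0" using P False by (simp add: K_def)
  have "real (card ?S) = (\<Sum>a\<in>?S. 1)" by simp
  also have "\<dots> \<le> (\<Sum>a\<in>?S. K powr (1 - s) * (\<Prod>i\<in>UNIV. real (a $ i) powr (s - 1)))"
  proof (rule sum_mono)
    fix a assume a: "a \<in> ?S"
    then have pos: "real (a $ i) > 0" for i by (auto simp: Suc_le_eq)
    have p: "(\<Prod>i\<in>UNIV. real (a $ i)) > 0" by (intro prod_pos pos ballI)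
    have "1 \<le> (K / (\<Prod>i\<in>UNIV. real (a $ i))) powr (1 - s)"
      using a p s by (intro ge_one_powr_ge_zero) (auto simp: K_def)
    also have "\<dots> = K powr (1 - s) * (\<Prod>i\<in>UNIV. real (a $ i)) powr (s - 1)"
      using p K by (simp add: powr_divide powr_diff field_simps)
    also have "(\<Prod>i\<in>UNIV. real (a $ i)) powr (s - 1) = (\<Prod>i\<in>UNIV. real (a $ i) powr (s - 1))"
      by (rule prod_powr_distrib)
    finally show "1 \<le> K powr (1 - s) * (\<Prod>i\<in>UNIV. real (a $ i) powr (s - 1))" .
  qed
  also have "\<dots> \<le> (\<Sum>a\<in>?A. K powr (1 - s) * (\<Prod>i\<in>UNIV. real (a $ i) powr (s - 1)))"
    by (intro sum_mono2 finite_vec) (auto intro!: mult_nonneg_nonneg prod_nonneg)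
  also have "\<dots> = K powr (1 - s) * (\<Sum>x\<in>{1..T}. real x powr (s - 1)) ^ CARD('n)"
    using sum_vec_prod[of "\<lambda>_ :: 'n. {1..T}" "\<lambda>_ x. real x powr (s - 1)"]
    by (simp flip: sum_distrib_left)
  also have "\<dots> \<le> K powr (1 - s) * (real T powr s / s) ^ CARD('n)"
    by (intro mult_left_mono power_mono sum_powr_le s sum_nonneg) auto
  also have "\<dots> = P powr (1 - s) * (real T powr (real CARD('n) * (1 - s)) * real T powr (real CARD('n) * s)) / s ^ CARD('n)"
    using P False by (simp add: K_def powr_mult power_divide powr_powr powr_power mult.commute flip: powr_realpow)
  also have "real T powr (real CARD('n) * (1 - s)) * real T powr (real CARD('n) * s) = real T ^ CARD('n)"
    using False by (simp add: algebra_simps flip: powr_add powr_realpow)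
  finally show ?thesis .
qed

lemma shifted_frobenius_le_if_small_expsums:
  fixes a :: "nat ^ 'n::finite" and N :: "'n \<Rightarrow> nat"
  assumes a: "a \<in> primitive_vectors" and N: "\<And>i. i \<noteq> m \<Longrightarrow> N i > 0" and l: "l > 0"
    and small: "(\<Sum>k\<in>{1..<a $ m}. \<Prod>i\<in>- {m}. expsum_ratio (N i) (real k * real (a $ i) / real (a $ m)) ^ l) < 1"
  shows "real_of_int (shifted_frobenius a) \<le> (\<Sum>i\<in>- {m}. real l * (real (N i) * real (a $ i)))"
proof -
  have "shifted_frobenius a \<le> (\<Sum>i\<in>- {m}. int (l * (N i - 1)) * int (a $ i)) + (\<Sum>i\<in>- {m}. int (a $ i))"
  proof (rule shifted_frobenius_le)
    fix r :: int
    obtain x where x: "\<And>j. j \<in> - {m} \<Longrightarrow> x j \<le> l * (N j - 1)"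
      "int (a $ m) dvd (\<Sum>j\<in>- {m}. int (x j) * int (a $ j)) - r"
      by (rule multiple_representable_if_small_expsums[of "- {m}" "a $ m" N "\<lambda>i. a $ i" l r])
        (use small N primitive_vectorsD(1)[OF a] in auto)
    have "(\<Sum>j\<in>- {m}. int (x j) * int (a $ j)) \<le> (\<Sum>i\<in>- {m}. int (l * (N i - 1)) * int (a $ i))"
      using x(1) by (intro sum_mono mult_right_mono) (auto simp flip: of_nat_mult)
    then show "\<exists>x. int (a $ m) dvd (\<Sum>i\<in>- {m}. int (x i) * int (a $ i)) - r \<and>
        (\<Sum>i\<in>- {m}. int (x i) * int (a $ i)) \<le> (\<Sum>i\<in>- {m}. int (l * (N i - 1)) * int (a $ i))"
      using x(2) by blast
  qed (rule primitive_vectorsD[OF a])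
  also have "\<dots> = (\<Sum>i\<in>- {m}. int (l * (N i - 1) + 1) * int (a $ i))"
    by (simp add: sum.distrib algebra_simps)
  \<comment> \<open>The summand 1 stems from the shift by the coordinates and is absorbed because
    \<open>l \<ge> 1\<close>.\<close>
  also have "\<dots> \<le> (\<Sum>i\<in>- {m}. int (l * N i) * int (a $ i))"
  proof (intro sum_mono mult_right_mono)
    fix i assume "i \<in> - {m}"
    then obtain k where "N i = Suc k" using N[of i] by (auto simp: gr0_conv_Suc)
    then show "int (l * (N i - 1) + 1) \<le> int (l * N i)" using l by simp
  qed auto
  finally have "real_of_int (shifted_frobenius a) \<le> real_of_int (\<Sum>i\<in>- {m}. int (l * N i) * int (a $ i))"
    by (simp only: of_int_le_iff)
  then show ?thesis by (simp add: mult_ac)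
qed

section \<open>The normalised Frobenius number and the choice of parameters\<close>

definition frobenius_ratio :: "nat ^ 'n::finite \<Rightarrow> real" where
  "frobenius_ratio a = real_of_int (shifted_frobenius a)
     / real (\<Prod>i\<in>UNIV. a $ i) powr (1 / (real CARD('n) - 1))"

lemma ex_min_coordinate:
  fixes a :: "'a::linorder ^ 'n::finite"
  shows "\<exists>m. \<forall>i. a $ m \<le> a $ i"
proof -
  have "Min (range (vec_nth a)) \<in> range (vec_nth a)" by (rule Min_in) auto
  then obtain m where "a $ m = Min (range (vec_nth a))" by (metis rangeE)
  then show ?thesis by (intro exI[of _ m]) simp
qed

lemma ex_max_coordinate:
  fixes a :: "'a::linorder ^ 'n::finite"
  shows "\<exists>m. \<forall>i. a $ i \<le> a $ m"
proof -
  have "Max (range (vec_nth a)) \<in> range (vec_nth a)" by (rule Max_in) auto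
  then obtain m where "a $ m = Max (range (vec_nth a))" by (metis rangeE)
  then show ?thesis by (intro exI[of _ m]) simp
qed

text \<open>For a smallest coordinate \<open>a\<^sub>m\<close> and a largest
  \<open>a\<^sub>M\<close>, Schur's bound is \<open>l * a\<^sub>m * a\<^sub>M\<close>, while the
  product of all coordinates is at least \<open>a\<^sub>M * a\<^sub>m ^ l\<close>; only
  \<open>l * a\<^sub>M powr (1 - 1 / l)\<close> survives. This serves both the vanishing of the tail
  and the control of \<open>R\<close> by \<open>T\<close>.\<close>

lemma frobenius_ratio_le:
  fixes a :: "nat ^ 'n::finite"
  assumes d: "CARD('n) \<ge> 2" and a: "a \<in> primitive_vectors" and A: "\<And>i. real (a $ i) \<le> A"
  shows "frobenius_ratio a \<le> (real CARD('n) - 1) * A powr (1 - 1 / (real CARD('n) - 1))"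
proof -
  define l where "l = real CARD('n) - 1"
  have l: "l \<ge> 1" using d by (simp add: l_def)
  obtain m where m: "\<And>i. a $ m \<le> a $ i" using ex_min_coordinate[of a] by blast
  obtain M where M: "\<And>i. a $ i \<le> a $ M" using ex_max_coordinate[of a] by blast
  have pos: "real (a $ i) > 0" for i using primitive_vectorsD(1)[OF a] by simp
  define p where "p = (\<Prod>i\<in>UNIV. real (a $ i))"
  have "p = real (a $ M) * (\<Prod>i\<in>- {M}. real (a $ i))"
    by (simp add: p_def Compl_eq_Diff_UNIV prod.remove[of UNIV M])
  also have "\<dots> \<ge> real (a $ M) * (\<Prod>i\<in>- {M}. real (a $ m))"
    using m by (intro mult_left_mono prod_mono) auto
  also have "(\<Prod>i\<in>- {M}. real (a $ m)) = real (a $ m) powr l"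
    using pos d by (simp add: Compl_eq_Diff_UNIV card_Diff_singleton l_def of_nat_diff flip: powr_realpow)
  finally have "(real (a $ M) * real (a $ m) powr l) powr (1 / l) \<le> p powr (1 / l)"
    using pos l by (intro powr_mono2) auto
  then have p_ge: "real (a $ M) powr (1 / l) * real (a $ m) \<le> p powr (1 / l)"
    using pos l by (simp add: powr_mult powr_powr)
  have p_pos: "p powr (1 / l) > 0" using pos by (simp add: p_def prod_pos)
  have "shifted_frobenius a \<le> (int CARD('n) - 1) * int (a $ m) * int (a $ M)"
    by (rule shifted_frobenius_le_Schur[OF a M])
  then have "real_of_int (shifted_frobenius a) \<le> real_of_int ((int CARD('n) - 1) * int (a $ m) * int (a $ M))"
    by (simp only: of_int_le_iff)
  also have "\<dots> = l * real (a $ M) powr (1 - 1 / l) * (real (a $ M) powr (1 / l) * real (a $ m))"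
    using pos[of M] by (simp add: l_def flip: powr_add)
  also have "\<dots> \<le> l * real (a $ M) powr (1 - 1 / l) * p powr (1 / l)"
    using l p_ge by (intro mult_left_mono) auto
  also have "\<dots> \<le> l * A powr (1 - 1 / l) * p powr (1 / l)"
    using l A[of M] by (intro mult_right_mono mult_left_mono powr_mono2) auto
  finally show ?thesis
    using p_pos by (simp add: frobenius_ratio_def p_def l_def divide_le_eq)
qed

lemma nat_floor_bounds:
  fixes x :: real
  assumes "x \<ge> 1"
  shows "nat \<lfloor>x\<rfloor> \<ge> 1" "real (nat \<lfloor>x\<rfloor>) \<le> x" "x \<le> 2 * real (nat \<lfloor>x\<rfloor>)"
proof -
  have *: "\<lfloor>x\<rfloor> \<ge> 1" using assms by simp
  then show "nat \<lfloor>x\<rfloor> \<ge> 1" by linarith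
  have "real (nat \<lfloor>x\<rfloor>) = real_of_int \<lfloor>x\<rfloor>" using * by simp
  moreover have "real_of_int \<lfloor>x\<rfloor> \<ge> 1" using * by linarith
  ultimately show "real (nat \<lfloor>x\<rfloor>) \<le> x" "x \<le> 2 * real (nat \<lfloor>x\<rfloor>)"
    by linarith+
qed

text \<open>Vectors whose product of coordinates is at most \<open>P T\<^sup>d\<close> are counted trivially. For the
  others the weight \<open>N'\<close> on the smallest coordinate may exceed the common weight \<open>N\<close> by the
  factor \<open>P powr - \<eta>\<close>; this power gain is what removes the logarithms.\<close>

lemma card_large_ratio_le_parameters:
  fixes T :: nat and R P N N' :: real
  defines "l \<equiv> CARD('n::finite) - 1"
  defines "\<eta> \<equiv> 1 / (2 * real l)"
  assumes d: "CARD('n) \<ge> 3" and T: "T \<ge> 1" and P: "0 < P" "P \<le> 1" and R: "R > 0"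
    and N_def: "N = R / (real l)\<^sup>2 * (P * real T) powr (1 / real l)" and N: "N \<ge> 1"
    and N'_def: "N' = N * P powr - \<eta>"
  shows "real (card {a :: nat ^ 'n. a \<in> primitive_vectors \<and> (\<forall>i. a $ i \<le> T) \<and> frobenius_ratio a > R})
    \<le> P powr (1 - \<eta>) * real T ^ CARD('n) / \<eta> ^ CARD('n)
      + (real CARD('n))\<^sup>2 * real l * 32 ^ l * real T ^ CARD('n) * (N' / N ^ l + real T / (N ^ (l - 1) * N'))"
    (is "real (card ?Bad) \<le> _")
proof -
  have l: "l \<ge> 2" "CARD('n) = l + 1" using d by (auto simp: l_def)
  \<comment> \<open>\<open>\<eta> \<le> 1 / d\<close> lets \<open>p powr \<eta>\<close> dominate the
    geometric mean; \<open>\<eta> \<le> 1 / l\<close> keeps the exponent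
    \<open>1 / l - \<eta>\<close> nonnegative, so that \<open>P\<close> may be replaced by
    \<open>p\<close>.\<close>
  have \<eta>: "0 < \<eta>" "\<eta> < 1" "\<eta> \<le> 1 / real (CARD('n))" "\<eta> \<le> 1 / real l"
    using l by (auto simp: \<eta>_def field_simps)
  have "P powr - \<eta> \<ge> 1" using P \<eta> by (simp add: powr_minus powr_le1 one_le_inverse)
  then have N': "N' \<ge> N" using N by (simp add: N'_def)
  define n0 n1 where "n0 = nat \<lfloor>N\<rfloor>" and "n1 = nat \<lfloor>N'\<rfloor>"
  have n0: "n0 \<ge> 1" "real n0 \<le> N" "N \<le> 2 * real n0"
    unfolding n0_def by (rule nat_floor_bounds[OF N])+
  have n1: "n0 \<le> n1" "real n1 \<le> N'" "N' \<le> 2 * real n1"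
    unfolding n0_def n1_def
    by (rule nat_mono[OF floor_mono[OF N']], rule nat_floor_bounds, use N N' in linarith,
        rule nat_floor_bounds, use N N' in linarith)
  define Small where "Small = {a :: nat ^ 'n. (\<forall>i. a $ i \<in> {1..T}) \<and> real (\<Prod>i\<in>UNIV. a $ i) \<le> P * real T ^ CARD('n)}"
  define wt where "wt j i = (if i = j then n1 else n0)" for i j :: 'n
  define Fail where "Fail j m = {a :: nat ^ 'n. a \<in> primitive_vectors \<and> (\<forall>i. a $ i \<le> T) \<and>
      1 \<le> (\<Sum>k\<in>{1..<a $ m}. \<Prod>i\<in>- {m}. expsum_ratio (wt j i) (real k * real (a $ i) / real (a $ m)) ^ l)}" for j m
  have fin: "finite {a :: nat ^ 'n. \<forall>i. a $ i \<in> {1..T}}" by (rule finite_vec) simp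
  have fin_Small: "finite Small"
    by (rule finite_subset[OF _ fin]) (auto simp: Small_def)
  have fin_Fail: "finite (Fail j m)" for j m
    by (rule finite_subset[OF _ fin]) (auto simp: Fail_def Suc_le_eq primitive_vectorsD(1))
  have cover: "?Bad \<subseteq> Small \<union> (\<Union>(j, m)\<in>{(j, m). j \<noteq> m}. Fail j m)"
  proof
    fix a assume "a \<in> ?Bad"
    then have a: "a \<in> primitive_vectors" "\<And>i. a $ i \<le> T" "frobenius_ratio a > R" by auto
    have pos: "0 < a $ i" for i by (rule primitive_vectorsD(1)[OF a(1)])
    show "a \<in> Small \<union> (\<Union>(j, m)\<in>{(j, m). j \<noteq> m}. Fail j m)"
    proof (cases "a \<in> Small")
      case False
      define p where "p = real (\<Prod>i\<in>UNIV. a $ i) / real T ^ CARD('n)"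
      have pP: "p > P"
        using False a(2) pos T by (auto simp: Small_def p_def Suc_le_eq field_simps)
      have "real (\<Prod>i\<in>UNIV. a $ i) \<le> real (\<Prod>i\<in>(UNIV :: 'n set). T)"
        using a(2) by (intro of_nat_mono prod_mono) auto
      then have p1: "p \<le> 1" using T by (simp add: p_def)
      define s where "s = real (\<Prod>i\<in>UNIV. a $ i) powr (1 / real l)"
      have s: "s = p powr (1 / real l) * real T powr (1 / real l) * real T"
      proof -
        have "real (\<Prod>i\<in>UNIV. a $ i) = p * real T * real T powr real l"
          using T l by (simp add: p_def powr_realpow)
        then show ?thesis
          unfolding s_def using T l pP P by (simp add: powr_mult powr_powr)
      qed
      have s_pos: "s > 0" using s T pP P by simp
      obtain j where j: "\<And>i. a $ j \<le> a $ i" using ex_min_coordinate[of a] by blast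
      \<comment> \<open>The modulus may be any coordinate except the smallest, which has to stay
        among the summands to receive the larger weight.\<close>
      obtain m where m: "m \<noteq> j"
        using d by (metis (full_types) UNIV_I card_1_singletonE card_le_Suc0_iff_eq finite numeral_3_eq_3 Suc_le_D not_less_eq_eq le_SucI)
      \<comment> \<open>The smallest coordinate is at most the geometric mean
        \<open>p powr (1 / d) * T\<close>.\<close>
      have aj: "real (a $ j) \<le> p powr \<eta> * real T"
      proof -
        have "real (a $ j) ^ CARD('n) = (\<Prod>i\<in>(UNIV :: 'n set). real (a $ j))" by simp
        also have "\<dots> \<le> (\<Prod>i\<in>UNIV. real (a $ i))"
          using j by (intro prod_mono) auto
        also have "\<dots> = p * real T ^ CARD('n)" using T by (simp add: p_def)
        finally have "(real (a $ j) ^ CARD('n)) powr (1 / real CARD('n)) \<le> (p * real T ^ CARD('n)) powr (1 / real CARD('n))"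
          by (intro powr_mono2) auto
        then have "real (a $ j) \<le> p powr (1 / real CARD('n)) * real T"
          using pos[of j] T pP P by (simp add: powr_mult powr_powr flip: powr_realpow)
        also have "\<dots> \<le> p powr \<eta> * real T"
          using \<eta> pP P p1 by (intro mult_right_mono powr_mono') auto
        finally show ?thesis .
      qed
      \<comment> \<open>There are \<open>l\<close> summands, each with a factor \<open>l\<close>; a
        budget of \<open>R / l\<^sup>2 * s\<close> for each makes the total \<open>R * s\<close>.
        This explains \<open>l\<^sup>2\<close> in \<open>N\<close>.\<close>
      have Ns: "N * real T \<le> R / (real l)\<^sup>2 * s"
      proof -
        have "N * real T = R / (real l)\<^sup>2 * (P powr (1 / real l) * real T powr (1 / real l) * real T)"
          using P T by (simp add: N_def powr_mult)
        also have "\<dots> \<le> R / (real l)\<^sup>2 * s"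
          unfolding s using R P pP by (intro mult_left_mono mult_right_mono powr_mono2) auto
        finally show ?thesis .
      qed
      have N's: "N' * (p powr \<eta> * real T) \<le> R / (real l)\<^sup>2 * s"
      proof -
        have "N' * (p powr \<eta> * real T) = R / (real l)\<^sup>2 * (P powr (1 / real l - \<eta>) * p powr \<eta> * real T powr (1 / real l) * real T)"
          using P T by (simp add: N'_def N_def powr_mult powr_diff powr_minus field_simps)
        also have "\<dots> \<le> R / (real l)\<^sup>2 * (p powr (1 / real l - \<eta>) * p powr \<eta> * real T powr (1 / real l) * real T)"
          using R P pP \<eta> by (intro mult_left_mono mult_right_mono powr_mono2) auto
        also have "p powr (1 / real l - \<eta>) * p powr \<eta> = p powr (1 / real l)"
          by (simp flip: powr_add)
        finally show ?thesis by (simp add: s)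
      qed
      have wt: "real (wt j i) * real (a $ i) \<le> R / (real l)\<^sup>2 * s" for i
      proof (cases "i = j")
        case True
        have "real n1 * real (a $ j) \<le> N' * (p powr \<eta> * real T)"
          using n1 aj N N' by (intro mult_mono) auto
        then show ?thesis using N's True by (simp add: wt_def)
      next
        case False
        have "real n0 * real (a $ i) \<le> N * real T"
          using n0 a(2) N by (intro mult_mono) auto
        then show ?thesis using Ns False by (simp add: wt_def)
      qed
      have "a \<in> Fail j m"
      proof (rule ccontr)
        assume "a \<notin> Fail j m"
        then have "(\<Sum>k\<in>{1..<a $ m}. \<Prod>i\<in>- {m}. expsum_ratio (wt j i) (real k * real (a $ i) / real (a $ m)) ^ l) < 1"
          using a by (auto simp: Fail_def not_le)
        then have "real_of_int (shifted_frobenius a) \<le> (\<Sum>i\<in>- {m}. real l * (real (wt j i) * real (a $ i)))"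
          using a(1) l n0 n1 by (intro shifted_frobenius_le_if_small_expsums) (auto simp: wt_def)
        also have "\<dots> \<le> (\<Sum>i\<in>- {m}. real l * (R / (real l)\<^sup>2 * s))"
          by (intro sum_mono mult_left_mono wt) auto
        also have "\<dots> = R * s"
          using l by (simp add: Compl_eq_Diff_UNIV card_Diff_singleton power2_eq_square)
        finally have "frobenius_ratio a \<le> R"
          using s_pos l by (simp add: frobenius_ratio_def s_def divide_le_eq)
        then show False using a(3) by simp
      qed
      then show ?thesis using m by blast
    qed simp
  qed
  have Small_le: "real (card Small) \<le> P powr (1 - \<eta>) * real T ^ CARD('n) / \<eta> ^ CARD('n)"
    unfolding Small_def by (intro card_small_product_le \<eta> P)
  let ?b = "real l * 32 ^ l * real T ^ CARD('n) * (N' / N ^ l + real T / (N ^ (l - 1) * N'))"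
  have Fail_le: "real (card (Fail j m)) \<le> ?b" if "j \<noteq> m" for j m
  proof -
    have "real (card (Fail j m)) \<le> real l * 16 ^ l * real T ^ (l + 1)
        * (real n1 / real n0 ^ l + real T / (real n0 ^ (l - 1) * real n1))"
      unfolding Fail_def l_def
      by (rule card_large_expsums_le[OF d that]) (use n0 n1 in \<open>auto simp: wt_def\<close>)
    \<comment> \<open>Rounding down loses at most a factor 2 in each of the \<open>l\<close> factors
      of a denominator, which turns \<open>16 ^ l\<close> into \<open>32 ^ l\<close>.\<close>
    also have "\<dots> \<le> real l * 16 ^ l * real T ^ (l + 1) * (2 ^ l * (N' / N ^ l + real T / (N ^ (l - 1) * N')))"
    proof (rule mult_left_mono)
      have "real n1 / real n0 ^ l \<le> N' / (N / 2) ^ l"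
        using n0 n1 N N' by (intro frac_le power_mono) auto
      moreover have "real T / (real n0 ^ (l - 1) * real n1) \<le> real T / ((N / 2) ^ (l - 1) * (N' / 2))"
        using n0 n1 N N' by (intro frac_le mult_mono power_mono mult_pos_pos zero_less_power) auto
      moreover have "N' / (N / 2) ^ l = 2 ^ l * (N' / N ^ l)"
        by (simp add: power_divide)
      moreover have "real T / ((N / 2) ^ (l - 1) * (N' / 2)) = 2 ^ l * (real T / (N ^ (l - 1) * N'))"
        using l by (cases l) (auto simp: power_divide)
      ultimately show "real n1 / real n0 ^ l + real T / (real n0 ^ (l - 1) * real n1)
          \<le> 2 ^ l * (N' / N ^ l + real T / (N ^ (l - 1) * N'))"
        by (simp add: distrib_left)
    qed simp
    also have "\<dots> = real l * (16 ^ l * 2 ^ l) * real T ^ (l + 1) * (N' / N ^ l + real T / (N ^ (l - 1) * N'))"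
      by (simp only: mult_ac)
    also have "(16 ^ l * 2 ^ l :: real) = 32 ^ l"
      by (simp flip: power_mult_distrib)
    finally have "real (card (Fail j m)) \<le> real l * 32 ^ l * real T ^ (l + 1) * (N' / N ^ l + real T / (N ^ (l - 1) * N'))" .
    then show ?thesis by (simp only: l(2))
  qed
  have "card ?Bad \<le> card (Small \<union> (\<Union>(j, m)\<in>{(j, m). j \<noteq> m}. Fail j m))"
    using fin_Small fin_Fail by (intro card_mono[OF _ cover]) auto
  also have "\<dots> \<le> card Small + card (\<Union>(j, m)\<in>{(j, m). j \<noteq> m}. Fail j m)"
    by (rule card_Un_le)
  also have "card (\<Union>(j, m)\<in>{(j, m). j \<noteq> m}. Fail j m) \<le> (\<Sum>(j, m)\<in>{(j, m). j \<noteq> m}. card (Fail j m))"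
    by (rule order_trans[OF card_UN_le]) (auto simp: case_prod_unfold)
  finally have "real (card ?Bad) \<le> real (card Small) + (\<Sum>(j, m)\<in>{(j, m). j \<noteq> m}. real (card (Fail j m)))"
    by (simp add: case_prod_unfold flip: of_nat_sum of_nat_add)
  also have "(\<Sum>(j, m)\<in>{(j, m). j \<noteq> m}. real (card (Fail j m))) \<le> (\<Sum>(j, m)\<in>{(j :: 'n, m :: 'n). j \<noteq> m}. ?b)"
    by (intro sum_mono) (use Fail_le in auto)
  also have "\<dots> \<le> (\<Sum>(j, m)\<in>(UNIV :: ('n \<times> 'n) set). ?b)"
    using N N' by (intro sum_mono2) auto
  also have "\<dots> = (real CARD('n))\<^sup>2 * ?b"
    by (simp add: case_prod_unfold card_prod power2_eq_square)
  finally show ?thesis using Small_le by (simp add: mult_ac)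
qed

text \<open>Small \<open>R\<close> is absorbed by the constant. For \<open>R \<ge> R0\<close> the
  parameters are balanced so that every contribution is a constant times
  \<open>T ^ d * R powr (- l / 2)\<close>.\<close>

lemma card_large_ratio_le:
  assumes d: "CARD('n::finite) \<ge> 3"
  shows "\<exists>C>0. \<forall>T R. T \<ge> 1 \<longrightarrow> R > 0 \<longrightarrow>
    real (card {a :: nat ^ 'n. a \<in> primitive_vectors \<and> (\<forall>i. a $ i \<le> T) \<and> frobenius_ratio a > R})
      \<le> C * real T ^ CARD('n) * R powr (- (real CARD('n) - 1) / 2)"
proof -
  define l where "l = CARD('n) - 1"
  define L where "L = real l"
  \<comment> \<open>This value equalises the gains for small and large denominators,
    \<open>P powr (1 / L - \<eta>)\<close> and \<open>P powr \<eta>\<close>.\<close>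
  define \<eta> where "\<eta> = 1 / (2 * L)"
  define c where "c = 1 / L\<^sup>2"
  \<comment> \<open>This threshold ensures \<open>N \<ge> 1\<close>: the power of \<open>R\<close>
    left in \<open>N\<close> is \<open>(L - 1) / (2 * L - 1)\<close>, at least \<open>1 / 3\<close>
    for \<open>L \<ge> 2\<close>, and \<open>c * R0 powr (1 / 3) = 1\<close>.\<close>
  define R0 where "R0 = c powr (- 3)"
  define C1 where "C1 = 1 / \<eta> ^ CARD('n) + (real CARD('n))\<^sup>2 * L * 32 ^ l * ((L + 1) / c ^ l)"
  have l: "l \<ge> 2" "CARD('n) = l + 1" using d by (auto simp: l_def)
  have L: "L \<ge> 2" "real CARD('n) - 1 = L" using l by (auto simp: L_def)
  have c: "0 < c" "c \<le> 1" using L by (auto simp: c_def divide_le_eq one_le_power)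
  have \<eta>: "0 < \<eta>" using L by (simp add: \<eta>_def)
  have R0: "R0 \<ge> 1" unfolding R0_def powr_minus using c by (intro one_le_inverse powr_le1) auto
  have "C1 > 0"
    unfolding C1_def using \<eta> L c by (intro add_pos_nonneg) auto
  have main: "real (card {a :: nat ^ 'n. a \<in> primitive_vectors \<and> (\<forall>i. a $ i \<le> T) \<and> frobenius_ratio a > R})
      \<le> (C1 + R0 powr (L / 2)) * real T ^ CARD('n) * R powr (- L / 2)"
    (is "real (card (?Bad T R)) \<le> _")
    if T: "T \<ge> 1" and R: "R > 0" for T :: nat and R :: real
  proof (cases "R < R0 \<or> ?Bad T R = {}")
    case True
    have "real (card (?Bad T R)) \<le> R0 powr (L / 2) * real T ^ CARD('n) * R powr (- L / 2)"
    proof (cases "?Bad T R = {}")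
      case True
      then show ?thesis by (simp only: card.empty) simp
    next
      case False
      with True have "R \<le> R0" by auto
      have "card (?Bad T R) \<le> card {a :: nat ^ 'n. \<forall>i. a $ i \<in> {1..T}}"
        by (intro card_mono finite_vec) (auto simp: Suc_le_eq primitive_vectorsD(1))
      then have "card (?Bad T R) \<le> T ^ CARD('n)"
        unfolding card_vec by simp
      then have "real (card (?Bad T R)) \<le> real T ^ CARD('n)"
        by (simp flip: of_nat_power)
      also have "\<dots> \<le> real T ^ CARD('n) * (R0 powr (L / 2) * R powr (- L / 2))"
      proof -
        have "R powr (L / 2) \<le> R0 powr (L / 2)" using R \<open>R \<le> R0\<close> L by (intro powr_mono2) auto
        then have "1 \<le> R0 powr (L / 2) * R powr (- L / 2)" using R by (simp add: powr_minus field_simps)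
        from mult_left_mono[OF this, of "real T ^ CARD('n)"] show ?thesis by simp
      qed
      finally show ?thesis by (simp add: mult_ac)
    qed
    also have "\<dots> \<le> (C1 + R0 powr (L / 2)) * real T ^ CARD('n) * R powr (- L / 2)"
      using \<open>C1 > 0\<close> by (intro mult_right_mono) auto
    finally show ?thesis .
  next
    case False
    then have RR0: "R \<ge> R0" by auto
    \<comment> \<open>A single bad vector ties \<open>R\<close> to \<open>T\<close>: its ratio
      exceeds \<open>R\<close> and is at most \<open>L * T powr (1 - 1 / L)\<close>.\<close>
    obtain a :: "nat ^ 'n" where a: "a \<in> primitive_vectors" "\<And>i. a $ i \<le> T" "R < frobenius_ratio a"
      using False by auto
    have "frobenius_ratio a \<le> (real CARD('n) - 1) * real T powr (1 - 1 / (real CARD('n) - 1))"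
      using d a by (intro frobenius_ratio_le) auto
    then have RT: "R \<le> L * real T powr (1 - 1 / L)" using a(3) L by simp
    define Z where "Z = R powr (- L / 2)"
    \<comment> \<open>\<open>P\<close> balances the two contributions: \<open>P powr (1 - \<eta>) = R powr (- L) * P powr (\<eta> - 1) = Z\<close>.\<close>
    define P where "P = R powr (- (L\<^sup>2 / (2 * L - 1)))"
    define N where "N = R / (real l)\<^sup>2 * (P * real T) powr (1 / real l)"
    define N' where "N' = N * P powr - \<eta>"
    have R1: "R \<ge> 1" using RR0 R0 by simp
    have P: "0 < P" "P \<le> 1"
      using R1 R L by (auto simp: P_def powr_minus inverse_le_1_iff ge_one_powr_ge_zero)
    have Z: "Z > 0" using R by (simp add: Z_def)
    have PZ: "P powr (1 - \<eta>) = Z"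
    proof -
      have e: "- (L\<^sup>2 / (2 * L - 1)) * (1 - \<eta>) = - L / 2"
        using L by (simp add: \<eta>_def field_simps power2_eq_square)
      show ?thesis by (simp only: P_def Z_def powr_powr e)
    qed
    have RZ: "R powr L = 1 / Z ^ 2"
      using R by (simp add: Z_def powr_power power2_eq_square powr_minus field_simps flip: powr_add)
    have N_eq: "N = c * R * P powr (1 / L) * real T powr (1 / L)"
      using P T by (simp add: N_def c_def L_def powr_mult)
    have N_pos: "N > 0" using P T c R by (simp add: N_eq)
    have "N \<ge> 1"
    proof -
      have "1 \<le> c * R powr (1 / 3)"
      proof -
        have "1 = c * R0 powr (1 / 3)" unfolding R0_def powr_powr using c by (simp add: powr_minus)
        also have "\<dots> \<le> c * R powr (1 / 3)" using c RR0 R0 by (intro mult_left_mono powr_mono2) auto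
        finally show ?thesis .
      qed
      also have "R powr (1 / 3) \<le> R powr (1 - L / (2 * L - 1))"
        using R1 L by (intro powr_mono) (auto simp: field_simps)
      also have "\<dots> = R * P powr (1 / L)"
      proof -
        have e: "- (L\<^sup>2 / (2 * L - 1)) * (1 / L) = - (L / (2 * L - 1))"
          using L by (simp add: power2_eq_square)
        have "P powr (1 / L) = R powr (- (L / (2 * L - 1)))"
          by (simp only: P_def powr_powr e)
        then show ?thesis
          using R powr_add[of R 1 "- (L / (2 * L - 1))"] by simp
      qed
      also have "c * (R * P powr (1 / L)) \<le> c * (R * P powr (1 / L)) * real T powr (1 / L)"
        using T c R L mult_left_mono[of 1 "real T powr (1 / L)" "c * (R * P powr (1 / L))"]
        by (simp add: ge_one_powr_ge_zero)
      finally show ?thesis using c by (simp add: N_eq mult_ac mult_left_mono)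
    qed
    have N_pow: "N ^ l = c ^ l * (1 / Z ^ 2) * P * real T"
    proof -
      have "N powr L = c powr L * R powr L * P * real T"
        using c R P T L by (simp add: N_eq powr_mult powr_powr)
      then show ?thesis
        using N_pos c by (simp add: RZ) (simp add: L_def powr_realpow)
    qed
    \<comment> \<open>The term from denominators up to \<open>N'\<close>. The bound on
      \<open>R\<close> by \<open>T\<close> gives \<open>N / T \<le> L * P powr (1 / L)\<close>, a
      gain that outweighs the loss \<open>P powr - \<eta>\<close> from \<open>N'\<close>.\<close>
    have first: "N' / N ^ l \<le> L / c ^ l * Z"
    proof -
      have "N / real T = c * R * P powr (1 / L) * real T powr (1 / L - 1)"
        using T by (simp add: N_eq powr_diff)
      also have "\<dots> \<le> 1 * (L * real T powr (1 - 1 / L)) * P powr (1 / L) * real T powr (1 / L - 1)"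
        using c RT R L by (intro mult_right_mono mult_mono) auto
      also have "\<dots> = L * P powr (1 / L) * (real T powr (1 - 1 / L) * real T powr (1 / L - 1))"
        by simp
      also have "real T powr (1 - 1 / L) * real T powr (1 / L - 1) = 1"
        using T by (simp flip: powr_add)
      finally have NT: "N / real T \<le> L * P powr (1 / L)" by simp
      have "N' / N ^ l = N / real T * (P powr - \<eta> / (c ^ l * (1 / Z ^ 2) * P))"
        by (simp add: N'_def N_pow mult_ac)
      also have "\<dots> \<le> L * P powr (1 / L) * (P powr - \<eta> / (c ^ l * (1 / Z ^ 2) * P))"
        using c P by (intro mult_right_mono NT) auto
      also have "\<dots> = L / c ^ l * Z ^ 2 * (P powr (1 / L) * P powr - \<eta> / P powr 1)"
        using P by (simp add: field_simps)
      also have "P powr (1 / L) * P powr - \<eta> / P powr 1 = P powr (- (1 - \<eta>))"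
        unfolding powr_add[symmetric] powr_diff[symmetric] by (simp add: \<eta>_def algebra_simps)
      also have "\<dots> = 1 / Z" by (simp only: powr_minus PZ) (simp add: field_simps)
      finally show ?thesis using Z by (simp add: power2_eq_square)
    qed
    have second: "real T / (N ^ (l - 1) * N') = 1 / c ^ l * Z"
    proof -
      have "N ^ (l - 1) * N' = N ^ l * P powr - \<eta>"
        using l by (cases l) (auto simp: N'_def)
      also have "\<dots> = c ^ l * (1 / Z ^ 2) * real T * (P powr 1 * P powr - \<eta>)"
        using P by (simp add: N_pow)
      also have "P powr 1 * P powr - \<eta> = Z"
        unfolding powr_add[symmetric] by (simp add: PZ)
      finally have "N ^ (l - 1) * N' = c ^ l * (1 / Z ^ 2) * real T * Z" .
      then show ?thesis using T Z c by (simp only:) (simp add: field_simps power2_eq_square)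
    qed
    have "real (card (?Bad T R)) \<le> P powr (1 - \<eta>) * real T ^ CARD('n) / \<eta> ^ CARD('n)
      + (real CARD('n))\<^sup>2 * L * 32 ^ l * real T ^ CARD('n) * (N' / N ^ l + real T / (N ^ (l - 1) * N'))"
      unfolding \<eta>_def L_def l_def
      by (rule card_large_ratio_le_parameters[OF d T P R])
        (use N_def \<open>N \<ge> 1\<close> N'_def in \<open>simp_all add: \<eta>_def L_def l_def\<close>)
    also have "\<dots> \<le> Z * real T ^ CARD('n) / \<eta> ^ CARD('n)
      + (real CARD('n))\<^sup>2 * L * 32 ^ l * real T ^ CARD('n) * (L / c ^ l * Z + 1 / c ^ l * Z)"
      unfolding PZ second using first L by (intro add_mono mult_left_mono order_refl) auto
    also have "\<dots> = C1 * real T ^ CARD('n) * Z"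
      unfolding C1_def by (simp add: distrib_right distrib_left add_divide_distrib mult_ac)
    also have "\<dots> \<le> (C1 + R0 powr (L / 2)) * real T ^ CARD('n) * Z"
      using Z by (intro mult_right_mono) auto
    finally show ?thesis by (simp add: Z_def)
  qed
  show ?thesis
    using main \<open>C1 > 0\<close> unfolding L(2) by (intro exI[of _ "C1 + R0 powr (L / 2)"]) (auto intro: add_pos_nonneg)
qed

subsection \<open>Primitive vectors in dilates\<close>

text \<open>Two solutions differ by a multiple of \<open>p\<close>, so \<open>(b - B) div p\<close>
  tells them apart.\<close>

lemma card_progression_multiples_le:
  fixes p Q B L :: nat
  assumes p: "p > 0" "coprime p Q"
  shows "card {b \<in> {B..<B + L}. p dvd 1 + Q * b} \<le> L div p + 1" (is "card ?S \<le> _")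
proof -
  have "card ?S \<le> card {..L div p}"
  proof (rule card_inj_on_le)
    show "inj_on (\<lambda>b. (b - B) div p) ?S"
    proof (rule linorder_inj_onI)
      fix b b' assume b: "b < b'" "b \<in> ?S" "b' \<in> ?S"
      have "p dvd (1 + Q * b') - (1 + Q * b)"
        using b by (intro dvd_diff_nat) auto
      then have "p dvd Q * (b' - b)"
        by (simp add: diff_mult_distrib2)
      then have "p dvd b' - b"
        using p by (simp add: coprime_dvd_mult_right_iff)
      then have "p \<le> b' - b" using b by (auto dest: dvd_imp_le)
      then have "(b - B) + p \<le> b' - B" using b by auto
      then have "((b - B) + p) div p \<le> (b' - B) div p" by (rule div_le_mono)
      then show "(b - B) div p \<noteq> (b' - B) div p" using p by simp
    qed auto
    show "(\<lambda>b. (b - B) div p) ` ?S \<subseteq> {..L div p}"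
      by (auto intro!: div_le_mono)
  qed simp
  then show ?thesis by simp
qed

lemma sum_inverse_squares_tail_le:
  assumes "M \<ge> 1"
  shows "(\<Sum>p\<in>{M<..U}. 1 / (real p)\<^sup>2) \<le> 1 / real M"
proof (cases "M \<le> U")
  case True
  have "(\<Sum>p\<in>{M<..U}. 1 / (real p)\<^sup>2) \<le> 1 / real M - 1 / real U"
    using True
  proof (induction U rule: dec_induct)
    case (step n)
    have "{M<..Suc n} = insert (Suc n) {M<..n}" using step by auto
    moreover have "1 / (real (Suc n))\<^sup>2 \<le> 1 / (real n * real (Suc n))"
      unfolding power2_eq_square using step assms by (intro divide_left_mono mult_right_mono mult_pos_pos) auto
    moreover have "1 / (real n * real (Suc n)) = 1 / real n - 1 / real (Suc n)"
      using step assms by (simp add: field_simps)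
    ultimately show ?case using step by simp
  qed simp
  also have "\<dots> \<le> 1 / real M" by simp
  finally show ?thesis .
qed (use assms in simp)

text \<open>Restricting to \<open>a \<equiv> 1\<close> modulo \<open>M!\<close> leaves only common prime factors above \<open>M\<close>, which
  are too rare to matter.\<close>

lemma card_primitive_in_box_ge:
  fixes B :: "'n::finite \<Rightarrow> nat" and L M U :: nat
  assumes d: "CARD('n) \<ge> 2" and M: "M \<ge> 1"
    and U: "\<And>i. 1 + fact M * (B i + L) \<le> U"
  shows "real L ^ CARD('n) - (2 * real L) ^ CARD('n) / real M - real U
    \<le> real (card {b :: nat ^ 'n. (\<forall>i. b $ i \<in> {B i..<B i + L}) \<and> (\<chi> i. 1 + fact M * b $ i) \<in> primitive_vectors})"
    (is "_ \<le> real (card ?Good)")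
proof -
  let ?Q = "fact M :: nat"
  let ?All = "{b :: nat ^ 'n. \<forall>i. b $ i \<in> {B i..<B i + L}}"
  let ?P = "{p \<in> {M<..U}. prime p}"
  define Bad where "Bad p = {b :: nat ^ 'n. \<forall>i. b $ i \<in> {b \<in> {B i..<B i + L}. p dvd 1 + ?Q * b}}" for p
  have fin: "finite ?All" by (rule finite_vec) simp
  have cover: "?All \<subseteq> ?Good \<union> (\<Union>p\<in>?P. Bad p)"
  proof
    fix b assume b: "b \<in> ?All"
    let ?a = "\<chi> i. 1 + ?Q * b $ i"
    show "b \<in> ?Good \<union> (\<Union>p\<in>?P. Bad p)"
    proof (cases "?a \<in> primitive_vectors")
      case False
      then have "Gcd (range (vec_nth ?a)) \<noteq> 1"
        by (auto simp: primitive_vectors_def)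
      then obtain p where p: "prime p" "p dvd Gcd (range (vec_nth ?a))"
        by (metis prime_factor_nat)
      have dvd: "p dvd 1 + ?Q * b $ i" for i
        using dvd_trans[OF p(2) Gcd_dvd[of "?a $ i"]] by simp
      have "p > M"
      proof (rule ccontr)
        assume "\<not> p > M"
        then have "p dvd ?Q" using prime_gt_0_nat[OF p(1)] by (intro dvd_fact) auto
        then have "p dvd 1" using dvd[of undefined] by (metis dvd_add_left_iff dvd_mult2)
        then show False using p(1) by simp
      qed
      moreover have "p \<le> U"
      proof -
        have "p \<le> 1 + ?Q * b $ undefined" using dvd[of undefined] by (intro dvd_imp_le) auto
        also have "\<dots> \<le> 1 + ?Q * (B undefined + L)"
          using b by (intro add_left_mono mult_left_mono) (auto intro: less_imp_le)
        also have "\<dots> \<le> U" by (rule U)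
        finally show ?thesis .
      qed
      ultimately have "p \<in> ?P" using p by simp
      moreover have "b \<in> Bad p" using b dvd by (simp add: Bad_def)
      ultimately show ?thesis by blast
    qed (use b in simp)
  qed
  have finBad: "finite (Bad p)" for p
    unfolding Bad_def by (rule finite_vec) simp
  \<comment> \<open>For \<open>p \<le> L\<close> the count is at most
    \<open>(2 * L / p) ^ d\<close>, summable over \<open>p\<close> as \<open>d \<ge> 2\<close>. For
    \<open>p > L\<close> at most one vector is left, and these sum to at most
    \<open>U\<close>.\<close>
  have Bad_le: "real (card (Bad p)) \<le> (2 * real L) ^ CARD('n) * (1 / (real p)\<^sup>2) + 1" if p: "p \<in> ?P" for p
  proof -
    have "coprime p ?Q"
      using p by (intro prime_imp_coprime) (auto simp: prime_dvd_fact_iff)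
    have "card (Bad p) \<le> (\<Prod>i\<in>(UNIV :: 'n set). L div p + 1)"
      unfolding Bad_def card_vec using p \<open>coprime p ?Q\<close>
      by (intro prod_mono conjI card_progression_multiples_le) (auto simp: prime_gt_0_nat)
    then have card_le: "card (Bad p) \<le> (L div p + 1) ^ CARD('n)" by simp
    show ?thesis
    proof (cases "p \<le> L")
      case True
      have p1: "real p \<ge> 1" using p M by auto
      have "real (L div p + 1) \<le> real L / real p + 1"
        using of_nat_div_le_of_nat[of L p, where 'a = real] by simp
      also have "\<dots> \<le> 2 * real L / real p"
        using True p1 by (simp add: field_simps)
      finally have "real (L div p + 1) ^ CARD('n) \<le> (2 * real L / real p) ^ CARD('n)"
        by (intro power_mono) auto
      also have "\<dots> = (2 * real L) ^ CARD('n) * (1 / real p) ^ CARD('n)"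
        by (simp add: power_divide)
      also have "\<dots> \<le> (2 * real L) ^ CARD('n) * (1 / real p) ^ 2"
        using p1 d by (intro mult_left_mono power_decreasing) auto
      finally show ?thesis
        using of_nat_mono[OF card_le, where 'a = real] by (simp add: power_one_over)
    next
      case False
      then have "card (Bad p) \<le> 1" using card_le by simp
      then have "real (card (Bad p)) \<le> 1" by simp
      then show ?thesis by (smt (verit) divide_nonneg_nonneg mult_nonneg_nonneg of_nat_0_le_iff zero_le_power zero_le_power2)
    qed
  qed
  have "L ^ CARD('n) = card ?All"
    by (simp only: card_vec) simp
  also have "\<dots> \<le> card (?Good \<union> (\<Union>p\<in>?P. Bad p))"
    using finBad by (intro card_mono[OF _ cover] finite_UnI finite_UN_I) (auto intro: finite_subset[OF _ fin])
  also have "\<dots> \<le> card ?Good + card (\<Union>p\<in>?P. Bad p)"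
    by (rule card_Un_le)
  also have "card (\<Union>p\<in>?P. Bad p) \<le> (\<Sum>p\<in>?P. card (Bad p))"
    by (rule card_UN_le) simp
  finally have "real (L ^ CARD('n)) \<le> real (card ?Good + (\<Sum>p\<in>?P. card (Bad p)))"
    by (simp only: of_nat_le_iff)
  then have "real L ^ CARD('n) \<le> real (card ?Good) + (\<Sum>p\<in>?P. real (card (Bad p)))"
    by simp
  also have "(\<Sum>p\<in>?P. real (card (Bad p))) \<le> (\<Sum>p\<in>?P. (2 * real L) ^ CARD('n) * (1 / (real p)\<^sup>2) + 1)"
    by (intro sum_mono Bad_le)
  also have "\<dots> \<le> (\<Sum>p\<in>{M<..U}. (2 * real L) ^ CARD('n) * (1 / (real p)\<^sup>2) + 1)"
    by (intro sum_mono2) auto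
  also have "\<dots> = (2 * real L) ^ CARD('n) * (\<Sum>p\<in>{M<..U}. 1 / (real p)\<^sup>2) + real (U - M)"
    by (simp add: sum.distrib sum_distrib_left)
  also have "\<dots> \<le> (2 * real L) ^ CARD('n) * (1 / real M) + real U"
    by (intro add_mono mult_left_mono sum_inverse_squares_tail_le M) auto
  finally show ?thesis by simp
qed

lemma primitive_in_dilate_le:
  fixes D :: "(real ^ 'n::finite) set"
  assumes D: "bounded D" and T: "T > 0" and a: "a \<in> primitive_in_dilate D T"
  shows "real (a $ i) \<le> T * (SUP x\<in>D. norm x)"
proof -
  obtain x where x: "x \<in> D" "(\<chi> i. real (a $ i)) = T *\<^sub>R x"
    using a by (auto simp: primitive_in_dilate_def)
  have "real (a $ i) \<le> norm (T *\<^sub>R x)"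
    unfolding x(2)[symmetric] using component_le_norm_cart[of "\<chi> i. real (a $ i)" i] by simp
  also have "\<dots> = T * norm x" using T by simp
  also have "\<dots> \<le> T * (SUP x\<in>D. norm x)"
    using D x(1) T by (intro mult_left_mono cSUP_upper) (auto simp: bounded_norm_comp bounded_imp_bdd_above)
  finally show ?thesis .
qed

lemma finite_primitive_in_dilate:
  fixes D :: "(real ^ 'n::finite) set"
  assumes "bounded D" "T > 0"
  shows "finite (primitive_in_dilate D T)"
  by (rule finite_subset[OF _ finite_vec[of "\<lambda>_. {..nat \<lfloor>T * (SUP x\<in>D. norm x)\<rfloor>}"]])
    (auto intro!: le_nat_floor primitive_in_dilate_le[OF assms])

text \<open>An interior point provides a cube inside \<open>D\<close>; in its dilate the vectors
  congruent to 1 modulo \<open>Q\<close> are counted by the preceding sieve. For \<open>T\<close>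
  below a fixed \<open>T1\<close>, nonemptiness alone provides the one element needed.\<close>

lemma card_primitive_in_dilate_ge:
  fixes D :: "(real ^ 'n::finite) set"
  assumes d: "CARD('n) \<ge> 2" and nonneg: "\<And>x i. x \<in> D \<Longrightarrow> 0 \<le> x $ i"
    and D: "bounded D" "interior D \<noteq> {}"
  shows "\<exists>c>0. \<forall>T>0. primitive_in_dilate D T \<noteq> {} \<longrightarrow> c * T ^ CARD('n) \<le> real (card (primitive_in_dilate D T))"
proof -
  let ?d = "CARD('n)"
  obtain u where "u \<in> interior D" using D(2) by auto
  then obtain e where e: "e > 0" "cball u e \<subseteq> D" by (auto simp: mem_interior_cball)
  \<comment> \<open>Small enough for the cube of side \<open>h\<close> at \<open>u\<close> to lie in
    the ball, by the \<open>l1\<close> norm.\<close>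
  define h where "h = e / real ?d"
  have h: "h > 0" using e by (simp add: h_def)
  have box: "x \<in> D" if "\<And>i. u $ i \<le> x $ i \<and> x $ i \<le> u $ i + h" for x
  proof -
    have "norm (x - u) \<le> (\<Sum>i\<in>UNIV. \<bar>(x - u) $ i\<bar>)" by (rule norm_le_l1_cart)
    also have "\<dots> \<le> (\<Sum>i\<in>(UNIV :: 'n set). h)"
    proof (rule sum_mono)
      fix i show "\<bar>(x - u) $ i\<bar> \<le> h" using that[of i] by simp
    qed
    also have "\<dots> = e" by (simp add: h_def)
    finally show ?thesis using e(2) by (auto simp: dist_norm norm_minus_commute)
  qed
  have u: "u $ i \<ge> 0" for i
    using box[of u] h by (intro nonneg) auto
  \<comment> \<open>Chosen so that the sieve loss \<open>(2 * L) ^ d / M\<close> is exactly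
    \<open>L ^ d / 4\<close>.\<close>
  define M :: nat where "M = 2 ^ (?d + 2)"
  define Q :: nat where "Q = fact M"
  define W where "W = (\<Sum>i\<in>UNIV. u $ i) + h + 1"
  \<comment> \<open>The three entries serve, in turn, to absorb the rounding of \<open>B\<close>
    into \<open>T * W\<close>, to make \<open>L\<close> at least \<open>T * h / (2 * Q)\<close>, and
    to make \<open>U\<close> at most \<open>L ^ d / 4\<close>.\<close>
  define T1 where "T1 = max (real Q) (max (2 * (1 + real Q) / h) (16 * (real Q)\<^sup>2 * W / h\<^sup>2))"
  have Q: "real Q \<ge> 1" by (simp add: Q_def)
  have W: "W > 0" "u $ i + h + 1 \<le> W" for i
    using h u member_le_sum[of i UNIV "\<lambda>i. u $ i"] sum_nonneg[of UNIV "\<lambda>i. u $ i"]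
    by (auto simp: W_def)
  have T1: "T1 > 0" using Q by (simp add: T1_def less_max_iff_disj)
  have large: "(h / (2 * real Q)) ^ ?d / 2 * T ^ ?d \<le> real (card (primitive_in_dilate D T))" if T: "T \<ge> T1" for T
  proof -
    have T': "T > 0" "T \<ge> real Q" "T * h \<ge> 2 * (1 + real Q)" "T * h\<^sup>2 \<ge> 16 * (real Q)\<^sup>2 * W"
    proof -
      show "T > 0" using T T1 by linarith
      show "T \<ge> real Q" "T * h \<ge> 2 * (1 + real Q)" "T * h\<^sup>2 \<ge> 16 * (real Q)\<^sup>2 * W"
        using T h by (auto simp: T1_def field_simps)
    qed
    define B where "B i = nat \<lceil>T * u $ i / real Q\<rceil>" for i
    \<comment> \<open>The \<open>- 1\<close> pays for the summand 1 in \<open>1 + Q * b\<close>; the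
      rounding up in \<open>B\<close> is paid for by the strict inequality
      \<open>b < B + L\<close>.\<close>
    define L where "L = nat \<lfloor>(T * h - 1) / real Q\<rfloor>"
    define U where "U = nat \<lfloor>T * W\<rfloor>"
    have "T * h - 1 \<ge> 0" using T'(3) Q by simp
    then have "(T * h - 1) / real Q \<ge> 0" by simp
    then have L: "real L \<le> (T * h - 1) / real Q" "(T * h - 1) / real Q - 1 \<le> real L"
      unfolding L_def by linarith+
    have QL: "real Q * real L \<le> T * h - 1" using L(1) Q by (simp add: field_simps)
    have L_ge: "T * h / (2 * real Q) \<le> real L"
    proof -
      have "T * h / (2 * real Q) \<le> (T * h - 1) / real Q - 1" using T'(3) Q by (simp add: field_simps)
      then show ?thesis using L(2) by linarith
    qed
    have "T * u $ i / real Q \<ge> 0" for i using T' Q u by simp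
    then have B: "T * u $ i / real Q \<le> real (B i)" "real (B i) \<le> T * u $ i / real Q + 1" for i
      unfolding B_def by (smt (verit) of_nat_nat of_int_ceiling_le_add_one le_of_int_ceiling zero_le_ceiling)+
    have QB: "T * u $ i \<le> real Q * real (B i)" "real Q * real (B i) \<le> T * u $ i + real Q" for i
      using B[of i] Q by (auto simp: field_simps)
    have U: "1 + fact M * (B i + L) \<le> U" for i
    proof -
      have "real (1 + Q * (B i + L)) \<le> T * u $ i + T * h + T"
        using QB(2)[of i] QL T' by (simp add: distrib_left)
      also have "\<dots> \<le> T * W" using mult_left_mono[OF W(2)[of i], of T] T'(1) by (simp add: distrib_left)
      finally show ?thesis unfolding U_def Q_def by (rule le_nat_floor)
    qed
    let ?Good = "{b :: nat ^ 'n. (\<forall>i. b $ i \<in> {B i..<B i + L}) \<and> (\<chi> i. 1 + fact M * b $ i) \<in> primitive_vectors}"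
    have "card ?Good \<le> card (primitive_in_dilate D T)"
    proof (rule card_inj_on_le[OF _ _ finite_primitive_in_dilate[OF D(1) T'(1)]])
      show "inj_on (\<lambda>b. \<chi> i. 1 + fact M * b $ i) ?Good"
        by (auto intro!: inj_onI simp: vec_eq_iff)
      show "(\<lambda>b. \<chi> i. 1 + fact M * b $ i) ` ?Good \<subseteq> primitive_in_dilate D T"
      proof (rule image_subsetI)
        fix b assume b: "b \<in> ?Good"
        let ?x = "(1 / T) *\<^sub>R (\<chi> i. real (1 + Q * b $ i))"
        have "?x \<in> D"
        proof (rule box)
          fix i
          have bi: "B i \<le> b $ i" "b $ i + 1 \<le> B i + L" using b by (auto simp: Suc_le_eq)
          have "real Q * real (B i) \<le> real Q * real (b $ i)" using bi(1) by (intro mult_left_mono) auto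
          moreover have "real Q * real (b $ i + 1) \<le> real Q * real (B i + L)"
            using bi(2) by (intro mult_left_mono of_nat_mono) auto
          ultimately have "T * u $ i \<le> real (1 + Q * b $ i)" "real (1 + Q * b $ i) \<le> T * (u $ i + h)"
            using QB[of i] QL by (auto simp: distrib_left)
          then show "u $ i \<le> ?x $ i \<and> ?x $ i \<le> u $ i + h"
            using T'(1) by (simp add: field_simps)
        qed
        moreover have "(\<chi> i. real (1 + Q * b $ i)) = T *\<^sub>R ?x" using T'(1) by simp
        ultimately have "(\<chi> i. real (1 + Q * b $ i)) \<in> (\<lambda>x. T *\<^sub>R x) ` D" by blast
        then show "(\<chi> i. 1 + fact M * b $ i) \<in> primitive_in_dilate D T"
          using b by (simp add: primitive_in_dilate_def Q_def)
      qed
    qed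
    then have "real L ^ ?d - (2 * real L) ^ ?d / real M - real U \<le> real (card (primitive_in_dilate D T))"
      using card_primitive_in_box_ge[of M B L U] d U by (simp add: M_def)
    moreover have "(2 * real L) ^ ?d / real M = real L ^ ?d / 4"
      by (simp add: M_def power_mult_distrib power_add)
    moreover have "real U \<le> real L ^ ?d / 4"
    proof -
      have "real U \<le> T * W" using T' W(1) by (simp add: U_def)
      also have "\<dots> \<le> (T * h / (2 * real Q))\<^sup>2 / 4"
        using mult_left_mono[OF T'(4), of "T / (16 * (real Q)\<^sup>2)"] T'(1) Q
        by (simp add: power2_eq_square field_simps)
      also have "\<dots> \<le> (real L)\<^sup>2 / 4"
        using L_ge T' h Q by (intro divide_right_mono power_mono) auto
      also have "\<dots> \<le> real L ^ ?d / 4"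
      proof (intro divide_right_mono power_increasing d)
        have "1 \<le> T * h / (2 * real Q)" using T'(3) Q by (simp add: field_simps)
        then show "1 \<le> real L" using L_ge by linarith
      qed simp
      finally show ?thesis .
    qed
    moreover have "(T * h / (2 * real Q)) ^ ?d \<le> real L ^ ?d"
      using L_ge T' h Q by (intro power_mono) auto
    moreover have "(h / (2 * real Q)) ^ ?d / 2 * T ^ ?d = (T * h / (2 * real Q)) ^ ?d / 2"
      by (simp add: power_mult_distrib power_divide)
    ultimately show ?thesis by linarith
  qed
  define c where "c = min ((h / (2 * real Q)) ^ ?d / 2) (1 / T1 ^ ?d)"
  have "c * T ^ ?d \<le> real (card (primitive_in_dilate D T))" if T: "T > 0" "primitive_in_dilate D T \<noteq> {}" for T
  proof (cases "T \<ge> T1")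
    case True
    have "c * T ^ ?d \<le> (h / (2 * real Q)) ^ ?d / 2 * T ^ ?d"
      using T by (intro mult_right_mono) (auto simp: c_def)
    then show ?thesis using large[OF True] by linarith
  next
    case False
    have "c * T ^ ?d \<le> 1 / T1 ^ ?d * T1 ^ ?d"
      using T T1 False by (intro mult_mono power_mono) (auto simp: c_def)
    also have "\<dots> = 1" using T1 by simp
    also have "\<dots> \<le> real (card (primitive_in_dilate D T))"
      using T(2) finite_primitive_in_dilate[OF D(1) T(1)] by (simp add: Suc_le_eq card_gt_0_iff)
    finally show ?thesis .
  qed
  moreover have "c > 0" using h Q T1 by (simp add: c_def)
  ultimately show ?thesis by blast
qed

subsection \<open>The tail bound\<close>

lemma frobenius_tail_altdef:
  fixes D :: "(real ^ 'n::finite) set"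
  shows "frobenius_tail D T R = real (card {a \<in> primitive_in_dilate D T. frobenius_ratio a > R})
    / real (card (primitive_in_dilate D T))"
  by (simp add: frobenius_tail_def frobenius_ratio_def)

text \<open>The dilate lies in a cube of side \<open>T * K\<close>, so the bad vectors are bounded
  by a multiple of \<open>T ^ d\<close>; the lower bound for all primitive vectors has the same
  order, and \<open>T\<close> cancels.\<close>

lemma frobenius_tail_le:
  fixes D :: "(real ^ 'n::finite) set"
  assumes d: "CARD('n) \<ge> 3" and nonneg: "\<And>x i. x \<in> D \<Longrightarrow> 0 \<le> x $ i"
    and D: "bounded D" "interior D \<noteq> {}"
  shows "\<exists>C>0. \<forall>T>0. primitive_in_dilate D T \<noteq> {} \<longrightarrow>
    (\<forall>R>0. frobenius_tail D T R \<le> C * R powr (- (real CARD('n) - 1) / 2))"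
proof -
  obtain C where C: "C > 0" "\<And>T R. T \<ge> 1 \<Longrightarrow> R > 0 \<Longrightarrow>
    real (card {a :: nat ^ 'n. a \<in> primitive_vectors \<and> (\<forall>i. a $ i \<le> T) \<and> frobenius_ratio a > R})
      \<le> C * real T ^ CARD('n) * R powr (- (real CARD('n) - 1) / 2)"
    using card_large_ratio_le[OF d] by blast
  have "CARD('n) \<ge> 2" using d by simp
  from card_primitive_in_dilate_ge[OF this nonneg D]
  obtain c where c: "c > 0" "\<And>T. T > 0 \<Longrightarrow> primitive_in_dilate D T \<noteq> {} \<Longrightarrow>
      c * T ^ CARD('n) \<le> real (card (primitive_in_dilate D T))"
    by blast
  define K where "K = max 1 (SUP x\<in>D. norm x)"
  have K: "K \<ge> 1" by (simp add: K_def)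
  show ?thesis
  proof (intro exI[of _ "C * K ^ CARD('n) / c"] conjI allI impI)
    show "C * K ^ CARD('n) / c > 0" using C c K by simp
    fix T R :: real
    assume T: "T > 0" and ne: "primitive_in_dilate D T \<noteq> {}" and R: "R > 0"
    let ?A = "primitive_in_dilate D T" and ?r = "R powr (- (real CARD('n) - 1) / 2)"
    define T0 where "T0 = nat \<lfloor>T * K\<rfloor>"
    have le: "real (a $ i) \<le> T * K" if "a \<in> ?A" for a i
    proof -
      have "T * (SUP x\<in>D. norm x) \<le> T * K" using T by (intro mult_left_mono) (auto simp: K_def)
      then show ?thesis using primitive_in_dilate_le[OF D(1) T that, of i] by linarith
    qed
    have le': "a $ i \<le> T0" if "a \<in> ?A" for a i
      unfolding T0_def by (rule le_nat_floor[OF le[OF that]])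
    have prim: "a \<in> primitive_vectors" if "a \<in> ?A" for a
      using that by (simp add: primitive_in_dilate_def)
    obtain a where a: "a \<in> ?A" using ne by blast
    have "T0 \<ge> 1" using le'[OF a, of undefined] primitive_vectorsD(1)[OF prim[OF a], of undefined] by linarith
    let ?B = "{a :: nat ^ 'n. a \<in> primitive_vectors \<and> (\<forall>i. a $ i \<le> T0) \<and> frobenius_ratio a > R}"
    have "card {a \<in> ?A. frobenius_ratio a > R} \<le> card ?B"
    proof (rule card_mono)
      show "finite ?B" by (rule finite_subset[OF _ finite_vec[of "\<lambda>_. {..T0}"]]) auto
      show "{a \<in> ?A. frobenius_ratio a > R} \<subseteq> ?B" using prim le' by blast
    qed
    then have "real (card {a \<in> ?A. frobenius_ratio a > R}) \<le> real (card ?B)" by simp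
    also have "\<dots> \<le> C * real T0 ^ CARD('n) * ?r"
      by (rule C(2)[OF \<open>T0 \<ge> 1\<close> R])
    also have "\<dots> \<le> C * (T * K) ^ CARD('n) * ?r"
    proof (intro mult_right_mono mult_left_mono power_mono)
      show "real T0 \<le> T * K" unfolding T0_def using T K by (intro of_nat_floor) simp
    qed (use C in auto)
    also have "\<dots> = C * K ^ CARD('n) / c * ?r * (c * T ^ CARD('n))"
      using c by (simp add: power_mult_distrib field_simps)
    also have "\<dots> \<le> C * K ^ CARD('n) / c * ?r * real (card ?A)"
      using c C K T by (intro mult_left_mono c(2) ne) auto
    finally have "real (card {a \<in> ?A. frobenius_ratio a > R}) \<le> C * K ^ CARD('n) / c * ?r * real (card ?A)" .
    moreover have "card ?A > 0"
      using ne finite_primitive_in_dilate[OF D(1) T] by (simp add: card_gt_0_iff)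
    ultimately show "frobenius_tail D T R \<le> C * K ^ CARD('n) / c * ?r"
      unfolding frobenius_tail_altdef by (simp only: divide_le_eq of_nat_0_less_iff if_True)
  qed
qed

lemma frobenius_tail_eq_0:
  fixes D :: "(real ^ 'n::finite) set"
  assumes d: "CARD('n) \<ge> 2" and D: "bounded D" and T: "T > 0"
    and R: "R \<ge> real CARD('n) * (T * (SUP x\<in>D. norm x)) powr (1 - 1 / (real CARD('n) - 1))"
  shows "frobenius_tail D T R = 0"
proof -
  have "frobenius_ratio a \<le> R" if a: "a \<in> primitive_in_dilate D T" for a
  proof -
    have "a \<in> primitive_vectors" using a by (simp add: primitive_in_dilate_def)
    then have "frobenius_ratio a
        \<le> (real CARD('n) - 1) * (T * (SUP x\<in>D. norm x)) powr (1 - 1 / (real CARD('n) - 1))"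
      by (intro frobenius_ratio_le[OF d] primitive_in_dilate_le[OF D T a])
    also have "\<dots> \<le> real CARD('n) * (T * (SUP x\<in>D. norm x)) powr (1 - 1 / (real CARD('n) - 1))"
      by (intro mult_right_mono) auto
    finally show ?thesis using R by linarith
  qed
  then have "{a \<in> primitive_in_dilate D T. frobenius_ratio a > R} = {}"
    by (auto simp: not_less)
  then show ?thesis
    by (simp only: frobenius_tail_altdef card.empty of_nat_0 div_0)
qed

theorem corollary1:
  fixes D :: "(real ^ 'n::finite) set"
  assumes "CARD('n) \<ge> 3"
    and "\<And>x i. x \<in> D \<Longrightarrow> 0 \<le> x $ i"
    and "bounded D"
    and "interior D \<noteq> {}"
  shows "(\<exists>C>0. \<forall>T>0. primitive_in_dilate D T \<noteq> {} \<longrightarrow>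
            (\<forall>R>0. frobenius_tail D T R
               \<le> C * R powr (- (1/2) * (real CARD('n) - 1))
                   * ln (R + 2) powr (1/2 * (real CARD('n) - 3))))
       \<and> (\<forall>T>0. primitive_in_dilate D T \<noteq> {} \<longrightarrow>
            (\<forall>R. R \<ge> real CARD('n) * (T * (SUP x\<in>D. norm x)) powr (1 - 1 / (real CARD('n) - 1))
               \<longrightarrow> frobenius_tail D T R = 0))"
proof (rule conjI)
  let ?e = "1/2 * (real CARD('n) - 3)"
  \<comment> \<open>The exponent is nonnegative for \<open>d \<ge> 3\<close>, so the logarithmic
    factor is at least \<open>?m\<close> for every \<open>R > 0\<close>; dividing the constant by
    \<open>?m\<close> inserts it into the bound.\<close>
  let ?m = "ln 2 powr ?e"
  obtain C where C: "C > 0" "\<And>T R. T > 0 \<Longrightarrow> primitive_in_dilate D T \<noteq> {} \<Longrightarrow> R > 0 \<Longrightarrow>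
      frobenius_tail D T R \<le> C * R powr (- (real CARD('n) - 1) / 2)"
    using frobenius_tail_le[OF assms] by blast
  show "\<exists>C>0. \<forall>T>0. primitive_in_dilate D T \<noteq> {} \<longrightarrow>
            (\<forall>R>0. frobenius_tail D T R
               \<le> C * R powr (- (1/2) * (real CARD('n) - 1))
                   * ln (R + 2) powr (1/2 * (real CARD('n) - 3)))"
  proof (intro exI[of _ "C / ?m"] conjI allI impI)
    have m: "?m > 0" by simp
    then show "C / ?m > 0" using C(1) by simp
    fix T R :: real
    assume T: "T > 0" "primitive_in_dilate D T \<noteq> {}" and R: "R > 0"
    let ?r = "R powr (- (1/2) * (real CARD('n) - 1))"
    have e: "- (real CARD('n) - 1) / 2 = - (1/2) * (real CARD('n) - 1)"
      by (simp add: field_simps)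
    have "frobenius_tail D T R \<le> C * ?r"
      using C(2)[OF T R] by (simp only: e)
    also have "\<dots> = C / ?m * ?r * ?m" using m by simp
    also have "\<dots> \<le> C / ?m * ?r * ln (R + 2) powr ?e"
      using C(1) R assms(1) by (intro mult_left_mono powr_mono2) auto
    finally show "frobenius_tail D T R \<le> C / ?m * ?r * ln (R + 2) powr ?e" .
  qed
  show "\<forall>T>0. primitive_in_dilate D T \<noteq> {} \<longrightarrow>
            (\<forall>R. R \<ge> real CARD('n) * (T * (SUP x\<in>D. norm x)) powr (1 - 1 / (real CARD('n) - 1))
               \<longrightarrow> frobenius_tail D T R = 0)"
    using frobenius_tail_eq_0[OF _ assms(3)] assms(1) by auto
qed

end
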